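(* Let $E/\mathbf{Q}$ be an elliptic curve and let $R\in E(\overline{\mathbf{Q}})$ be a point of order $4$. The following are equivalent. i) The group $\langle R\rangle$ is Galois-stable. ii) For all $\sigma\in\mathrm{Gal}(\overline{\mathbf{Q}}/\mathbf{Q})$ we have $\sigma R=\pm R$. iii) We have $x(R)\in\mathbf{Q}$, where $x(R)$ denotes the $x$-coordinate of $R$. iv) $E/\mathbf{Q}$ has a model $y^2=x(x^2+\gamma x+\delta^2)$ with $\gamma\in\mathbf{Q}$, $\delta\in\mathbf{Q}^\times$, and $\gamma^2-4\delta^2\neq0$, where (in this model) $x(R)\in\{\pm\delta\}$ and $2R=(0,0)$.
   Context: A subgroup of $E(\overline{\mathbf{Q}})$ is Galois-stable if it is mapped to itself by every element of $\mathrm{Gal}(\overline{\mathbf{Q}}/\mathbf{Q})$. A model of $E/\mathbf{Q}$ is a Weierstrass equation over $\mathbf{Q}$ (here of the form $y^2=$ cubic in $x$) defining an elliptic curve isomorphic to $E$ over $\mathbf{Q}$; in iii) the $x$-coordinate is taken with respect to any such model (the condition does not depend on which). *)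

theory Defs
  imports
    "HOL-Algebra.Algebraic_Closure_Type"
    "HOL-Algebra.Generated_Groups"
begin

text \<open>\<open>Weierstrass a1 a2 a3 a4 a6\<close> stands for
  \<open>y^2 + a1 x y + a3 y = x^3 + a2 x^2 + a4 x + a6\<close>.
  Base change along a field homomorphism is the map function of the datatype.\<close>

datatype 'a weierstrass =
  Weierstrass (wa1: 'a) (wa2: 'a) (wa3: 'a) (wa4: 'a) (wa6: 'a)

definition on_curve :: "'a::field weierstrass \<Rightarrow> 'a \<Rightarrow> 'a \<Rightarrow> bool" where
  "on_curve W x y \<longleftrightarrow>
     y^2 + wa1 W * x * y + wa3 W * y = x^3 + wa2 W * x^2 + wa4 W * x + wa6 W"

definition discriminant :: "'a::field weierstrass \<Rightarrow> 'a" where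
  "discriminant W =
     (let b2 = wa1 W ^ 2 + 4 * wa2 W;
          b4 = 2 * wa4 W + wa1 W * wa3 W;
          b6 = wa3 W ^ 2 + 4 * wa6 W;
          b8 = wa1 W ^ 2 * wa6 W + 4 * wa2 W * wa6 W - wa1 W * wa3 W * wa4 W
                 + wa2 W * wa3 W ^ 2 - wa4 W ^ 2
      in - (b2 ^ 2 * b8) - 8 * b4 ^ 3 - 27 * b6 ^ 2 + 9 * b2 * b4 * b6)"

definition elliptic_curve :: "'a::field weierstrass \<Rightarrow> bool" where
  "elliptic_curve W \<longleftrightarrow> discriminant W \<noteq> 0"

text \<open>\<open>Infinity\<close> is the origin of the group law; \<open>xcoord\<close> and \<open>ycoord\<close> are
  meaningful for affine points only.\<close>

datatype 'a ec_point = Infinity | Affine (xcoord: 'a) (ycoord: 'a)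

definition ec_points :: "'a::field weierstrass \<Rightarrow> 'a ec_point set" where
  "ec_points W = insert Infinity {Affine x y | x y. on_curve W x y}"

fun ec_neg :: "'a::field weierstrass \<Rightarrow> 'a ec_point \<Rightarrow> 'a ec_point" where
  "ec_neg W Infinity = Infinity"
| "ec_neg W (Affine x y) = Affine x (- y - wa1 W * x - wa3 W)"

text \<open>The chord-tangent law: \<open>l\<close> is the slope of the line through the two points,
  or of the tangent line if they coincide.\<close>

fun ec_add :: "'a::field weierstrass \<Rightarrow> 'a ec_point \<Rightarrow> 'a ec_point \<Rightarrow> 'a ec_point" where
  "ec_add W Infinity Q = Q"
| "ec_add W P Infinity = P"
| "ec_add W (Affine x1 y1) (Affine x2 y2) =
     (if Affine x2 y2 = ec_neg W (Affine x1 y1) then Infinity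
      else
        let l = (if x1 = x2
                 then (3 * x1^2 + 2 * wa2 W * x1 + wa4 W - wa1 W * y1) /
                      (2 * y1 + wa1 W * x1 + wa3 W)
                 else (y2 - y1) / (x2 - x1));
            x3 = l^2 + wa1 W * l - wa2 W - x1 - x2
        in ec_neg W (Affine x3 (l * (x3 - x1) + y1)))"

definition ec_group :: "'a::field weierstrass \<Rightarrow> 'a ec_point monoid" where
  "ec_group W = \<lparr>carrier = ec_points W, monoid.mult = ec_add W, one = Infinity\<rparr>"

abbreviation ec_group_Qbar :: "rat weierstrass \<Rightarrow> rat alg_closure ec_point monoid" where
  "ec_group_Qbar E \<equiv> ec_group (map_weierstrass to_ac E)"

text \<open>Written for an arbitrary monoid record, as the corresponding constant of the locale
  \<^locale>\<open>group\<close> can only be unfolded where the group axioms have been proved.\<close>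

definition has_order :: "('a, 'b) monoid_scheme \<Rightarrow> 'a \<Rightarrow> nat \<Rightarrow> bool" where
  "has_order G a n \<longleftrightarrow>
     a \<in> carrier G \<and> n > 0 \<and> a [^]\<^bsub>G\<^esub> n = \<one>\<^bsub>G\<^esub> \<and>
     (\<forall>m. 0 < m \<and> m < n \<longrightarrow> a [^]\<^bsub>G\<^esub> m \<noteq> \<one>\<^bsub>G\<^esub>)"

definition Gal_Qbar :: "(rat alg_closure \<Rightarrow> rat alg_closure) set" where
  "Gal_Qbar = {\<sigma>. bij \<sigma> \<and> (\<forall>x y. \<sigma> (x + y) = \<sigma> x + \<sigma> y) \<and>
                  (\<forall>x y. \<sigma> (x * y) = \<sigma> x * \<sigma> y) \<and> (\<forall>q. \<sigma> (to_ac q) = to_ac q)}"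

definition galois_stable :: "rat alg_closure ec_point set \<Rightarrow> bool" where
  "galois_stable H \<longleftrightarrow> (\<forall>\<sigma>\<in>Gal_Qbar. map_ec_point \<sigma> ` H = H)"

text \<open>\<open>Coord_change u r s t\<close> with \<open>u \<noteq> 0\<close> is the substitution
  \<open>x = u^2 x' + r\<close>, \<open>y = u^3 y' + s u^2 x' + t\<close>. The isomorphisms over a field between
  elliptic curves given by Weierstrass equations are exactly these, with \<open>u, r, s, t\<close>
  in that field.\<close>

datatype 'a coord_change = Coord_change (cu: 'a) (cr: 'a) (cs: 'a) (ct: 'a)

fun change_point :: "'a::field coord_change \<Rightarrow> 'a ec_point \<Rightarrow> 'a ec_point" where
  "change_point C Infinity = Infinity"
| "change_point (Coord_change u r s t) (Affine x y) =
     Affine ((x - r) / u^2) ((y - t - s * (x - r)) / u^3)"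

fun change_curve :: "'a::field coord_change \<Rightarrow> 'a weierstrass \<Rightarrow> 'a weierstrass" where
  "change_curve (Coord_change u r s t) (Weierstrass a1 a2 a3 a4 a6) =
     Weierstrass
       ((a1 + 2 * s) / u)
       ((a2 - s * a1 + 3 * r - s^2) / u^2)
       ((a3 + r * a1 + 2 * t) / u^3)
       ((a4 - s * a3 + 2 * r * a2 - (t + r * s) * a1 + 3 * r^2 - 2 * s * t) / u^4)
       ((a6 + r * a4 + r^2 * a2 + r^3 - t * a3 - t^2 - r * t * a1) / u^6)"

lemma on_curve_change:
  assumes "u \<noteq> 0" and "on_curve W x y"
    and "change_point (Coord_change u r s t) (Affine x y) = Affine x' y'"
  shows "on_curve (change_curve (Coord_change u r s t) W) x' y'"
proof -
  obtain a1 a2 a3 a4 a6 where W: "W = Weierstrass a1 a2 a3 a4 a6" by (cases W)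
  have x: "x = u^2 * x' + r" and y: "y = u^3 * y' + s * u^2 * x' + t"
    using assms(1,3) by auto
  let ?l = "y'^2 + (a1 + 2 * s) / u * x' * y' + (a3 + r * a1 + 2 * t) / u^3 * y'"
  let ?r = "x'^3 + (a2 - s * a1 + 3 * r - s^2) / u^2 * x'^2
       + (a4 - s * a3 + 2 * r * a2 - (t + r * s) * a1 + 3 * r^2 - 2 * s * t) / u^4 * x'
       + (a6 + r * a4 + r^2 * a2 + r^3 - t * a3 - t^2 - r * t * a1) / u^6"
  have l: "u^6 * ?l = u^6 * y'^2 + (a1 + 2 * s) * u^5 * x' * y' + (a3 + r * a1 + 2 * t) * u^3 * y'"
    using assms(1) by (simp add: field_simps flip: power_add) (simp add: algebra_simps eval_nat_numeral)
  have r: "u^6 * ?r = u^6 * x'^3 + (a2 - s * a1 + 3 * r - s^2) * u^4 * x'^2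
       + (a4 - s * a3 + 2 * r * a2 - (t + r * s) * a1 + 3 * r^2 - 2 * s * t) * u^2 * x'
       + (a6 + r * a4 + r^2 * a2 + r^3 - t * a3 - t^2 - r * t * a1)"
    using assms(1) by (simp add: field_simps eval_nat_numeral)
  have "u^6 * ?l - u^6 * ?r =
      y^2 + a1 * x * y + a3 * y - (x^3 + a2 * x^2 + a4 * x + a6)"
    unfolding l r x y by (simp add: algebra_simps eval_nat_numeral)
  also have "\<dots> = 0" using assms(2) by (simp add: W on_curve_def)
  finally have "u^6 * ?l = u^6 * ?r" by simp
  then show ?thesis using assms(1) by (simp add: W on_curve_def)
qed

text \<open>\<open>is_model E C M\<close>: \<open>M\<close> is a model \<open>y^2 = cubic\<close> of \<open>E\<close>, and \<open>C\<close> is the chosen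
  isomorphism from \<open>E\<close> to \<open>M\<close>, all over the base field.\<close>

definition is_model :: "'a::field weierstrass \<Rightarrow> 'a coord_change \<Rightarrow> 'a weierstrass \<Rightarrow> bool" where
  "is_model E C M \<longleftrightarrow> cu C \<noteq> 0 \<and> change_curve C E = M \<and> wa1 M = 0 \<and> wa3 M = 0"

lemma ex_model: "\<exists>C M. is_model (E :: 'a::field_char_0 weierstrass) C M"
proof (intro exI)
  show "is_model E (Coord_change 1 0 (- (wa1 E / 2)) (- (wa3 E / 2)))
          (change_curve (Coord_change 1 0 (- (wa1 E / 2)) (- (wa3 E / 2))) E)"
    by (cases E) (simp add: is_model_def)
qed

abbreviation change_point_Qbar ::
  "rat coord_change \<Rightarrow> rat alg_closure ec_point \<Rightarrow> rat alg_closure ec_point" where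
  "change_point_Qbar C \<equiv> change_point (map_coord_change to_ac C)"

end

theory Submission
  imports Defs
begin

text \<open>Write \<open>T = 2R\<close>. A point \<open>R\<close> of order 4 generates \<open>{O, R, T, -R}\<close>, and \<open>T\<close> is the only
element of order 2 there (\<open>order_four_generate\<close>, \<open>order_four_neg_double\<close>). An automorphism
\<open>\<sigma>\<close> respects the chord-tangent law, because its formulas have rational coefficients. So
if \<open>\<sigma>\<close> preserves the group it can only send \<open>R\<close> to \<open>R\<close> or \<open>-R\<close>: the points
\<open>O\<close> and \<open>T\<close> equal their own negatives and \<open>R\<close> does not. Conversely, if \<open>\<sigma>R = \<plusminus>R\<close>, then
\<open>\<sigma>\<close> permutes the four points.

On a model \<open>y^2 = cubic\<close> the negative of \<open>(x, y)\<close> is \<open>(x, -y)\<close>, and two points are equal up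
to sign exactly if they have the same \<open>x\<close>. Hence \<open>\<sigma>R = \<plusminus>R\<close> for all \<open>\<sigma>\<close> means that every \<open>\<sigma>\<close>
fixes \<open>x(R)\<close>, and this says that \<open>x(R)\<close> is rational: an irrational algebraic number is moved by
some automorphism of the algebraic closure (\<open>Gal_Qbar_moves_irrational\<close>). The last fact is
proved by sending \<open>x\<close> to another root of its minimal polynomial and extending this embedding of
\<open>\<rat>(x)\<close> to the whole closure with Zorn's lemma.

If \<open>x(R)\<close> is rational, then so is \<open>x(T)\<close>, by the duplication formula, while \<open>y(T) = 0\<close> as
\<open>T = -T\<close>. Moving \<open>T\<close> to the origin gives a model \<open>y^2 = x (x^2 + \<gamma> x + \<beta>)\<close> over \<open>\<rat>\<close>. The
tangent at \<open>R = (\<rho>, y)\<close> passes through the origin, so it is \<open>y = l x\<close>, and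
\<open>x (x^2 + \<gamma> x + \<beta>) - l^2 x^2 = x (x - \<rho>)^2\<close>. Comparing the coefficients of \<open>x\<close> yields
\<open>\<beta> = \<rho>^2\<close>, so that \<open>\<delta> = \<rho>\<close> works; \<open>\<gamma>^2 \<noteq> 4 \<delta>^2\<close> because the discriminant does not vanish.
Conversely, \<open>x(R) = \<plusminus>\<delta>\<close> in one model makes \<open>x(R)\<close> rational in every model, since models differ
by rational substitutions.

The addition table of \<open>{O, R, T, -R}\<close> follows from \<open>T + R = -R\<close> and \<open>T = -T\<close>, from
commutativity, and from the compatibility of negation with addition; the latter holds because
negation is itself induced by a change of coordinates (\<open>ec_neg_add\<close>).\<close>

section \<open>Extending embeddings to the algebraic closure\<close>

text \<open>Embeddings are encoded by their graphs, so that one extends another exactly if its graph is larger;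
this lets Zorn's lemma for the inclusion order apply.\<close>

definition partial_embedding :: "('a::field alg_closure \<times> 'a alg_closure) set \<Rightarrow> bool" where
  "partial_embedding G \<longleftrightarrow>
     single_valued G \<and> (\<forall>q. (to_ac q, to_ac q) \<in> G) \<and>
     (\<forall>(x, x') \<in> G. \<forall>(y, y') \<in> G. (x + y, x' + y') \<in> G \<and> (x * y, x' * y') \<in> G)"

lemma partial_embeddingD:
  assumes "partial_embedding G"
  shows "(to_ac q, to_ac q) \<in> G"
    and "(x, x') \<in> G \<Longrightarrow> (x, x'') \<in> G \<Longrightarrow> x' = x''"
    and "(x, x') \<in> G \<Longrightarrow> (y, y') \<in> G \<Longrightarrow> (x + y, x' + y') \<in> G"
    and "(x, x') \<in> G \<Longrightarrow> (y, y') \<in> G \<Longrightarrow> (x * y, x' * y') \<in> G"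
  using assms unfolding partial_embedding_def single_valued_def by (simp, blast, blast, blast)

lemma partial_embedding_minus:
  assumes G: "partial_embedding G" and "(x, x') \<in> G"
  shows "(- x, - x') \<in> G"
  using partial_embeddingD(4)[OF G partial_embeddingD(1)[OF G, of "-1"] assms(2)] by simp

lemma partial_embedding_poly:
  assumes G: "partial_embedding G" and "(x, x') \<in> G"
  shows "(poly (map_poly to_ac p) x, poly (map_poly to_ac p) x') \<in> G"
proof (induction p)
  case 0
  then show ?case using partial_embeddingD(1)[OF G, of 0] by simp
next
  case (pCons c p)
  then show ?case
    by (simp add: map_poly_pCons partial_embeddingD[OF G] assms(2))
qed

text \<open>A ring between a field and an algebraic extension of it is a field: if
\<open>c + x q(x) = 0\<close> with \<open>c \<noteq> 0\<close>, then \<open>-q(x)/c\<close> is the inverse of \<open>x\<close> and lies in the ring.\<close>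

lemma partial_embedding_inverse:
  fixes x :: "'a::field alg_closure"
  assumes G: "partial_embedding G" and xG: "(x, x') \<in> G" and "x \<noteq> 0"
  shows "(inverse x, inverse x') \<in> G"
proof -
  obtain p :: "'a poly" where "p \<noteq> 0" "poly (map_poly to_ac p) x = 0"
    using alg_closure_algebraic .
  then have "\<exists>q. (q :: 'a poly) \<noteq> 0 \<and> coeff q 0 \<noteq> 0 \<and> poly (map_poly to_ac q) x = 0"
  proof (induction p)
    case (pCons c p)
    show ?case
    proof (cases "c = 0")
      case True
      then show ?thesis using pCons \<open>x \<noteq> 0\<close> by (simp add: map_poly_pCons)
    next
      case False
      then show ?thesis using pCons by (intro exI[of _ "pCons c p"]) simp
    qed
  qed simp
  then obtain c q where "c \<noteq> 0" and cq: "poly (map_poly to_ac (pCons c q)) x = 0"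
    by (metis coeff_pCons_0 pCons_cases)
  then have "to_ac c = - (x * poly (map_poly to_ac q) x)"
    by (simp add: map_poly_pCons eq_neg_iff_add_eq_0)
  define z where "z = to_ac (- inverse c) * poly (map_poly to_ac q) x"
  define z' where "z' = to_ac (- inverse c) * poly (map_poly to_ac q) x'"
  have zG: "(z, z') \<in> G"
    unfolding z_def z'_def
    by (intro partial_embeddingD[OF G] partial_embedding_poly[OF G] xG)
  have "x * z = - (x * poly (map_poly to_ac q) x) * to_ac (inverse c)"
    by (simp add: z_def)
  also have "\<dots> = 1"
    unfolding \<open>to_ac c = _\<close>[symmetric] using \<open>c \<noteq> 0\<close> by simp
  finally have xz: "x * z = 1" .
  have "(1, x' * z') \<in> G" using partial_embeddingD(4)[OF G xG zG] xz by simp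
  moreover have "(1, 1) \<in> G" using partial_embeddingD(1)[OF G, of 1] by simp
  ultimately have "x' * z' = 1" using partial_embeddingD(2)[OF G] by blast
  then show ?thesis using zG xz by (metis inverse_unique)
qed

definition embedding_of :: "('a::field alg_closure \<times> 'a alg_closure) set \<Rightarrow> 'a alg_closure \<Rightarrow> 'a alg_closure" where
  "embedding_of G x = (THE y. (x, y) \<in> G)"

definition coeffs_in :: "'a::zero set \<Rightarrow> 'a poly \<Rightarrow> bool" where
  "coeffs_in K p \<longleftrightarrow> (\<forall>i. coeff p i \<in> K)"

definition minimal_poly_over :: "'a::comm_ring_1 set \<Rightarrow> 'a \<Rightarrow> 'a poly \<Rightarrow> bool" where
  "minimal_poly_over K a m \<longleftrightarrow> coeffs_in K m \<and> m \<noteq> 0 \<and> poly m a = 0 \<and>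
     (\<forall>p. coeffs_in K p \<longrightarrow> p \<noteq> 0 \<longrightarrow> poly p a = 0 \<longrightarrow> degree m \<le> degree p)"

lemma minimal_poly_overD:
  assumes "minimal_poly_over K a m"
  shows "coeffs_in K m" "m \<noteq> 0" "poly m a = 0"
    and "coeffs_in K p \<Longrightarrow> p \<noteq> 0 \<Longrightarrow> poly p a = 0 \<Longrightarrow> degree m \<le> degree p"
  using assms unfolding minimal_poly_over_def by blast+

context
  fixes G :: "('a::field alg_closure \<times> 'a alg_closure) set"
  assumes G: "partial_embedding G"
begin

lemma embedding_of_eq: "(x, y) \<in> G \<Longrightarrow> embedding_of G x = y"
  unfolding embedding_of_def using partial_embeddingD(2)[OF G] by blast

lemma Domain_closed:
  shows "to_ac q \<in> Domain G" "0 \<in> Domain G" "1 \<in> Domain G"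
    and "x \<in> Domain G \<Longrightarrow> y \<in> Domain G \<Longrightarrow> x + y \<in> Domain G"
    and "x \<in> Domain G \<Longrightarrow> y \<in> Domain G \<Longrightarrow> x * y \<in> Domain G"
    and "x \<in> Domain G \<Longrightarrow> - x \<in> Domain G"
    and "x \<in> Domain G \<Longrightarrow> inverse x \<in> Domain G"
proof -
  show *: "to_ac q \<in> Domain G" for q
    using partial_embeddingD(1)[OF G] by blast
  show 0: "0 \<in> Domain G" "1 \<in> Domain G" using *[of 0] *[of 1] by simp_all
  show "x \<in> Domain G \<Longrightarrow> inverse x \<in> Domain G"
    using partial_embedding_inverse[OF G] 0 by (cases "x = 0") auto
qed (use partial_embeddingD(3,4)[OF G] partial_embedding_minus[OF G] in blast)+

lemma Domain_sum: "(\<And>i. i \<in> A \<Longrightarrow> g i \<in> Domain G) \<Longrightarrow> sum g A \<in> Domain G"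
  by (induction A rule: infinite_finite_induct) (auto intro: Domain_closed simp del: Domain_iff)

lemma embedding_of_hom:
  shows "embedding_of G (to_ac q) = to_ac q" "embedding_of G 0 = 0" "embedding_of G 1 = 1"
    and "x \<in> Domain G \<Longrightarrow> y \<in> Domain G \<Longrightarrow>
      embedding_of G (x + y) = embedding_of G x + embedding_of G y"
    and "x \<in> Domain G \<Longrightarrow> y \<in> Domain G \<Longrightarrow>
      embedding_of G (x * y) = embedding_of G x * embedding_of G y"
proof -
  show *: "embedding_of G (to_ac q) = to_ac q" for q
    by (rule embedding_of_eq) (rule partial_embeddingD(1)[OF G])
  show "embedding_of G 0 = 0" "embedding_of G 1 = 1" using *[of 0] *[of 1] by simp_all
  assume "x \<in> Domain G" "y \<in> Domain G"
  then obtain x' y' where xy: "(x, x') \<in> G" "(y, y') \<in> G" by blast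
  show "embedding_of G (x + y) = embedding_of G x + embedding_of G y"
    "embedding_of G (x * y) = embedding_of G x * embedding_of G y"
    using xy partial_embeddingD(3,4)[OF G xy] by (simp_all add: embedding_of_eq)
qed

lemma embedding_of_sum:
  "(\<And>i. i \<in> A \<Longrightarrow> g i \<in> Domain G) \<Longrightarrow>
    embedding_of G (sum g A) = (\<Sum>i\<in>A. embedding_of G (g i))"
  by (induction A rule: infinite_finite_induct)
    (auto simp: embedding_of_hom Domain_sum simp del: Domain_iff)

lemma coeffs_in_Domain:
  shows "coeffs_in (Domain G) p \<Longrightarrow> coeffs_in (Domain G) q \<Longrightarrow> coeffs_in (Domain G) (p + q)"
    and "coeffs_in (Domain G) p \<Longrightarrow> coeffs_in (Domain G) q \<Longrightarrow> coeffs_in (Domain G) (p * q)"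
    and "coeffs_in (Domain G) p \<Longrightarrow> coeffs_in (Domain G) (- p)"
    and "c \<in> Domain G \<Longrightarrow> coeffs_in (Domain G) (monom c n)"
    and "coeffs_in (Domain G) (map_poly to_ac r)"
  unfolding coeffs_in_def
  by (auto simp: coeff_mult coeff_map_poly intro!: Domain_closed Domain_sum simp del: Domain_iff)

lemma map_poly_embedding_of:
  assumes "coeffs_in (Domain G) p" "coeffs_in (Domain G) q"
  shows "map_poly (embedding_of G) (p + q) = map_poly (embedding_of G) p + map_poly (embedding_of G) q"
    and "map_poly (embedding_of G) (p * q) = map_poly (embedding_of G) p * map_poly (embedding_of G) q"
  using assms unfolding coeffs_in_def
  by (auto intro!: poly_eqI
      simp: coeff_map_poly embedding_of_hom coeff_mult embedding_of_sum Domain_closed simp del: Domain_iff)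

text \<open>This makes the assignment \<open>p(a) \<mapsto> (f p)(b)\<close> well defined when \<open>b\<close> is a root of the image
\<open>f m\<close> of the minimal polynomial. The induction carries out the division by
\<open>m\<close> one leading term at a time; the remainder vanishes by minimality.\<close>

lemma coeffs_in_vanishing_transfer:
  assumes minimal: "minimal_poly_over (Domain G) a m"
    and b: "poly (map_poly (embedding_of G) m) b = 0"
  shows "coeffs_in (Domain G) p \<Longrightarrow> poly p a = 0 \<Longrightarrow> poly (map_poly (embedding_of G) p) b = 0"
proof (induction "degree p" arbitrary: p rule: less_induct)
  case less
  note m = minimal_poly_overD(1-3)[OF minimal]
  show ?case
  proof (cases "p = 0")
    case False
    then have deg: "degree m \<le> degree p" using minimal_poly_overD(4)[OF minimal] less.prems by blast
    \<comment> \<open>\<open>s * m\<close> cancels the leading term of \<open>p\<close>.\<close>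
    define c where "c = lead_coeff p * inverse (lead_coeff m)"
    define s where "s = monom c (degree p - degree m)"
    define r where "r = p + - (s * m)"
    have s: "coeffs_in (Domain G) s" 
      unfolding s_def c_def
      using less.prems(1) m(1) by (intro coeffs_in_Domain Domain_closed) (auto simp: coeffs_in_def)
    have sm: "coeffs_in (Domain G) (s * m)"
      by (rule coeffs_in_Domain(2)[OF s m(1)])
    have r: "coeffs_in (Domain G) r"
      unfolding r_def by (intro coeffs_in_Domain less.prems sm)
    have c0: "c \<noteq> 0" using False m(2) by (simp add: c_def)
    have "poly r a = 0" using less.prems(2) m(3) by (simp add: r_def)
    have rb: "poly (map_poly (embedding_of G) r) b = 0"
    proof (cases "r = 0")
      case False
      have "degree (s * m) = degree p"
        using c0 m(2) deg by (simp add: s_def degree_mult_eq degree_monom_eq)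
      moreover have "coeff (s * m) (degree p) = lead_coeff p"
        using m(2) deg by (simp add: s_def coeff_monom_mult c_def)
      ultimately have "degree r \<le> degree p" "coeff r (degree p) = 0"
        by (simp_all add: r_def degree_diff_le)
      then have "degree r < degree p"
        using False by (metis le_neq_implies_less leading_coeff_0_iff)
      then show ?thesis using less.hyps r \<open>poly r a = 0\<close> by blast
    qed simp
    have "p = r + s * m" by (simp add: r_def)
    then have "map_poly (embedding_of G) p =
        map_poly (embedding_of G) r + map_poly (embedding_of G) s * map_poly (embedding_of G) m"
      using map_poly_embedding_of[OF r sm] map_poly_embedding_of(2)[OF s m(1)] by simp
    then show ?thesis using rb b by simp
  qed simp
qed

lemma ex_minimal_poly: "\<exists>m. minimal_poly_over (Domain G) a m"
proof -
  obtain r :: "'a poly" where r: "r \<noteq> 0" "poly (map_poly to_ac r) a = 0"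
    using alg_closure_algebraic .
  let ?P = "\<lambda>p. coeffs_in (Domain G) p \<and> p \<noteq> 0 \<and> poly p a = 0"
  have "?P (map_poly to_ac r)"
    using r coeffs_in_Domain(5) by (simp add: map_poly_eq_0_iff)
  then have "\<exists>m. ?P m \<and> (\<forall>p. ?P p \<longrightarrow> degree m \<le> degree p)"
    by (rule ex_has_least_nat)
  then show ?thesis unfolding minimal_poly_over_def by blast
qed

lemma extend_partial_embedding:
  assumes minimal: "minimal_poly_over (Domain G) a m"
    and b: "poly (map_poly (embedding_of G) m) b = 0"
  shows "\<exists>H. partial_embedding H \<and> G \<subseteq> H \<and> (a, b) \<in> H"
proof -
  let ?f = "map_poly (embedding_of G)"
  define H where "H = {(poly p a, poly (?f p) b) | p. coeffs_in (Domain G) p}"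
  have H: "(poly p a, poly (?f p) b) \<in> H" if "coeffs_in (Domain G) p" for p
    using that by (auto simp: H_def)
  have const: "(x, y) \<in> H" if "(x, y) \<in> G" for x y
    using H[OF coeffs_in_Domain(4), of x 0] that
    by (auto simp: monom_0 map_poly_pCons embedding_of_hom embedding_of_eq)
  have "single_valued H"
    unfolding single_valued_def
  proof (intro allI impI)
    fix x y z assume "(x, y) \<in> H" "(x, z) \<in> H"
    then obtain p q where p: "coeffs_in (Domain G) p" "x = poly p a" "y = poly (?f p) b"
      and q: "coeffs_in (Domain G) q" "x = poly q a" "z = poly (?f q) b"
      by (auto simp: H_def)
    let ?d = "p + - q"
    have d: "coeffs_in (Domain G) ?d" using p q by (intro coeffs_in_Domain)
    have "poly (?f ?d) b = 0"
      by (rule coeffs_in_vanishing_transfer[OF minimal b d]) (use p q in auto)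
    moreover have "?f p = ?f ?d + ?f q"
      using map_poly_embedding_of(1)[OF d q(1)] by simp
    ultimately show "y = z" using p q by simp
  qed
  moreover have "(x + y, x' + y') \<in> H \<and> (x * y, x' * y') \<in> H"
    if xy: "(x, x') \<in> H" "(y, y') \<in> H" for x x' y y'
  proof -
    obtain p q where p: "coeffs_in (Domain G) p" "x = poly p a" "x' = poly (?f p) b"
      and q: "coeffs_in (Domain G) q" "y = poly q a" "y' = poly (?f q) b"
      using xy by (auto simp: H_def)
    show ?thesis
      using H[OF coeffs_in_Domain(1)[OF p(1) q(1)]] H[OF coeffs_in_Domain(2)[OF p(1) q(1)]]
      by (simp add: p q map_poly_embedding_of)
  qed
  ultimately have "partial_embedding H"
    using const partial_embeddingD(1)[OF G] unfolding partial_embedding_def by blast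
  moreover have "(a, b) \<in> H"
    using H[OF coeffs_in_Domain(4)[OF Domain_closed(3)], of 1]
    by (simp add: monom_altdef map_poly_pCons embedding_of_hom)
  ultimately show ?thesis using const by auto
qed

text \<open>Since the closure is algebraically closed, the image of the minimal polynomial of \<open>a\<close> has a root
to which \<open>a\<close> can be sent.\<close>

lemma extend_partial_embedding_to_element:
  "\<exists>H. partial_embedding H \<and> G \<subseteq> H \<and> a \<in> Domain H"
proof -
  obtain m where minimal: "minimal_poly_over (Domain G) a m"
    using ex_minimal_poly by blast
  note m = minimal_poly_overD(1-3)[OF minimal]
  have lc: "lead_coeff m \<in> Domain G" using m by (simp add: coeffs_in_def)
  have deg0: "degree m \<noteq> 0"
  proof
    assume "degree m = 0"
    then obtain c where "m = [:c:]" by (rule degree_eq_zeroE)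
    then show False using m by simp
  qed
  have "embedding_of G (lead_coeff m) * embedding_of G (inverse (lead_coeff m)) = 1"
    using embedding_of_hom(5)[OF lc Domain_closed(7)[OF lc]] m embedding_of_hom(3) by simp
  then have "coeff (map_poly (embedding_of G) m) (degree m) \<noteq> 0"
    by (auto simp: coeff_map_poly embedding_of_hom)
  then have "degree (map_poly (embedding_of G) m) > 0"
    using deg0 le_degree by fastforce
  then obtain b where "poly (map_poly (embedding_of G) m) b = 0"
    using alg_closed_imp_poly_has_root by blast
  then show ?thesis using extend_partial_embedding[OF minimal] by (meson Domain.intros)
qed

end

text \<open>A maximal embedding above \<open>G\<close> is defined everywhere, as otherwise it could be extended by one more
element.\<close>

lemma extend_to_endomorphism:
  assumes G: "partial_embedding G"
  shows "\<exists>H. partial_embedding H \<and> G \<subseteq> H \<and> Domain H = UNIV"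
proof -
  define A where "A = {H. partial_embedding H \<and> G \<subseteq> H}"
  have "\<exists>M\<in>A. \<forall>H\<in>A. M \<subseteq> H \<longrightarrow> H = M"
  proof (rule subset_Zorn_nonempty)
    show "A \<noteq> {}" using G by (auto simp: A_def)
    fix \<C> assume ne: "\<C> \<noteq> {}" and ch: "subset.chain A \<C>"
    have sub: "partial_embedding H" "G \<subseteq> H" if "H \<in> \<C>" for H
      using ch that by (auto simp: subset_chain_def A_def)
    have common: "\<exists>H\<in>\<C>. u \<in> H \<and> v \<in> H" if uv: "u \<in> \<Union>\<C>" "v \<in> \<Union>\<C>" for u v
    proof -
      obtain U V where UV: "U \<in> \<C>" "u \<in> U" "V \<in> \<C>" "v \<in> V" using uv by blast
      then have "U \<subseteq> V \<or> V \<subseteq> U" using ch by (simp add: subset_chain_def)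
      then show ?thesis using UV by blast
    qed
    have "single_valued (\<Union>\<C>)"
    proof (rule single_valuedI)
      fix x y z assume "(x, y) \<in> \<Union>\<C>" "(x, z) \<in> \<Union>\<C>"
      then obtain H where H: "H \<in> \<C>" "(x, y) \<in> H" "(x, z) \<in> H" using common by blast
      then show "y = z" using partial_embeddingD(2)[OF sub(1)] by blast
    qed
    moreover have "(to_ac q, to_ac q) \<in> \<Union>\<C>" for q
      using ne partial_embeddingD(1)[OF sub(1)] by blast
    moreover have "(x + y, x' + y') \<in> \<Union>\<C> \<and> (x * y, x' * y') \<in> \<Union>\<C>"
      if xy: "(x, x') \<in> \<Union>\<C>" "(y, y') \<in> \<Union>\<C>" for x x' y y'
    proof -
      obtain H where "H \<in> \<C>" "(x, x') \<in> H" "(y, y') \<in> H" using common[OF xy] by blast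
      then show ?thesis using partial_embeddingD(3,4)[OF sub(1)] by blast
    qed
    ultimately have "partial_embedding (\<Union>\<C>)"
      unfolding partial_embedding_def by blast
    then show "\<Union>\<C> \<in> A" using ne sub by (auto simp: A_def)
  qed
  then obtain M where M: "partial_embedding M" "G \<subseteq> M"
    and max: "\<And>H. partial_embedding H \<Longrightarrow> M \<subseteq> H \<Longrightarrow> H = M"
    unfolding A_def by (auto 0 3)
  have "a \<in> Domain M" for a
    using extend_partial_embedding_to_element[OF M(1), of a] max by blast
  then show ?thesis using M by blast
qed

text \<open>Surjectivity holds because an endomorphism maps the finite set of roots of a nonzero polynomial
over the base field injectively into itself, and every element is a root of such a polynomial.\<close>

lemma endomorphism_bij:
  fixes f :: "'a::field alg_closure \<Rightarrow> 'a alg_closure"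
  assumes add: "\<And>x y. f (x + y) = f x + f y" and mult: "\<And>x y. f (x * y) = f x * f y"
    and base: "\<And>q. f (to_ac q) = to_ac q"
  shows "bij f"
proof -
  have 0: "f 0 = 0" and 1: "f 1 = 1" using base[of 0] base[of 1] by simp_all
  have inj: "inj f"
  proof (rule injI)
    fix x y assume xy: "f x = f y"
    have "f (x - y) + f y = f x" by (simp flip: add)
    then have "f (x - y) = 0" using xy by simp
    moreover have "f (x - y) * f (inverse (x - y)) = 1" if "x \<noteq> y"
      using that 1 by (simp flip: mult)
    ultimately show "x = y" by fastforce
  qed
  have poly: "poly (map_poly to_ac p) (f x) = f (poly (map_poly to_ac p) x)" for p x
    by (induction p) (simp_all add: map_poly_pCons 0 add mult base)
  have "y \<in> range f" for y
  proof -
    obtain p :: "'a poly" where p: "p \<noteq> 0" "poly (map_poly to_ac p) y = 0"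
      using alg_closure_algebraic .
    let ?Z = "{x. poly (map_poly to_ac p) x = 0}"
    have "finite ?Z" using p by (intro poly_roots_finite) (simp add: map_poly_eq_0_iff)
    moreover have "f ` ?Z \<subseteq> ?Z" by (auto simp: poly 0)
    ultimately have "f ` ?Z = ?Z" by (meson endo_inj_surj inj inj_on_subset subset_UNIV)
    then show ?thesis using p by blast
  qed
  then show ?thesis using inj by (auto simp: bij_def)
qed

lemma to_ac_rat: "to_ac (q :: rat) = of_rat q"
  by (cases q) (simp add: Fract_of_int_quotient of_rat_divide)

lemma Rats_alg_closure: "(\<rat> :: rat alg_closure set) = range to_ac"
  by (auto simp: Rats_def to_ac_rat)

text \<open>An irrational \<open>x\<close> has a minimal polynomial \<open>m = (X - x) q\<close> over \<open>\<rat>\<close> with \<open>q\<close> not constant. In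
characteristic 0 the derivative of \<open>m\<close> is a nonzero polynomial of smaller degree, so it does not
vanish at \<open>x\<close>, whence \<open>q(x) \<noteq> 0\<close>. Any root \<open>b\<close> of \<open>q\<close> is therefore a conjugate different from \<open>x\<close>.\<close>

lemma Gal_Qbar_moves_irrational:
  assumes "x \<notin> \<rat>"
  shows "\<exists>\<sigma>\<in>Gal_Qbar. \<sigma> x \<noteq> x"
proof -
  define G :: "(rat alg_closure \<times> rat alg_closure) set" where "G = range (\<lambda>q. (to_ac q, to_ac q))"
  have G: "partial_embedding G"
    by (auto simp: partial_embedding_def G_def single_valued_def image_iff simp flip: to_ac_add to_ac_mult)
  have dom: "Domain G = range to_ac" by (auto simp: G_def)
  obtain m where minimal: "minimal_poly_over (Domain G) x m"
    using ex_minimal_poly[OF G] by blast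
  note m = minimal_poly_overD(1-3)[OF minimal]
  obtain q where q: "m = [:- x, 1:] * q" using m(3) by (metis poly_eq_0_iff_dvd dvdE)
  have degm: "degree m = Suc (degree q)"
    using m(2) unfolding q by (subst degree_mult_eq) auto
  have "degree q > 0"
  proof (rule ccontr)
    assume "\<not> degree q > 0"
    then obtain c where c: "q = [:c:]" by (meson degree_eq_zeroE not_gr_zero)
    then have "m = [:- x * c, c:]" by (simp add: q)
    then have "- x * c \<in> \<rat>" "c \<in> \<rat>"
      using m(1) by (auto simp: dom Rats_alg_closure coeffs_in_def coeff_pCons split: nat.splits)
    then have "(- x * c) / c \<in> \<rat>" by (rule Rats_divide)
    moreover have "c \<noteq> 0" using c q m(2) by auto
    ultimately show False using assms by simp
  qed
  then obtain b where b: "poly q b = 0" using alg_closed_imp_poly_has_root by blast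
  have "coeffs_in (Domain G) (pderiv m)"
    unfolding coeffs_in_def
  proof
    fix i
    have "coeff m (Suc i) \<in> Domain G" using m(1) by (simp add: coeffs_in_def)
    moreover have "of_nat (Suc i) \<in> Domain G"
      unfolding dom by (metis rangeI to_ac_of_nat)
    ultimately show "coeff (pderiv m) i \<in> Domain G"
      unfolding coeff_pderiv by (intro Domain_closed[OF G])
  qed
  moreover have "pderiv m \<noteq> 0" "degree (pderiv m) < degree m"
    using degm by (simp_all add: pderiv_eq_0_iff degree_pderiv)
  ultimately have "poly (pderiv m) x \<noteq> 0" using minimal_poly_overD(4)[OF minimal, of "pderiv m"] by auto
  then have "poly q x \<noteq> 0" unfolding q pderiv_mult by (simp add: pderiv_pCons)
  then have "b \<noteq> x" using b by auto
  have "map_poly (embedding_of G) m = m"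
  proof (rule poly_eqI)
    fix i
    obtain c where c: "coeff m i = to_ac c"
      using m(1) unfolding dom coeffs_in_def by blast
    show "coeff (map_poly (embedding_of G) m) i = coeff m i"
      by (simp add: coeff_map_poly embedding_of_hom[OF G] c)
  qed
  then have "poly (map_poly (embedding_of G) m) b = 0" using b by (simp add: q)
  then obtain H0 where H0: "partial_embedding H0" "(x, b) \<in> H0"
    using extend_partial_embedding[OF G minimal] by blast
  obtain H where H: "partial_embedding H" "(x, b) \<in> H" "Domain H = UNIV"
    using extend_to_endomorphism[OF H0(1)] H0(2) by blast
  let ?\<sigma> = "embedding_of H"
  have hom: "?\<sigma> (y + z) = ?\<sigma> y + ?\<sigma> z" "?\<sigma> (y * z) = ?\<sigma> y * ?\<sigma> z"
    "?\<sigma> (to_ac r) = to_ac r" for y z r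
    using embedding_of_hom[OF H(1)] H(3) by auto
  then have "?\<sigma> \<in> Gal_Qbar"
    unfolding Gal_Qbar_def using endomorphism_bij[of ?\<sigma>] by blast
  moreover have "?\<sigma> x = b" using embedding_of_eq[OF H(1,2)] .
  ultimately show ?thesis using \<open>b \<noteq> x\<close> by blast
qed

section \<open>The chord-tangent law\<close>

definition ec_slope :: "'a::field weierstrass \<Rightarrow> 'a \<Rightarrow> 'a \<Rightarrow> 'a \<Rightarrow> 'a \<Rightarrow> 'a" where
  "ec_slope W x1 y1 x2 y2 =
     (if x1 = x2
      then (3 * x1^2 + 2 * wa2 W * x1 + wa4 W - wa1 W * y1) / (2 * y1 + wa1 W * x1 + wa3 W)
      else (y2 - y1) / (x2 - x1))"

lemma ec_add_affine:
  assumes "Affine x2 y2 \<noteq> ec_neg W (Affine x1 y1)"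
    and "l = ec_slope W x1 y1 x2 y2" and "x3 = l^2 + wa1 W * l - wa2 W - x1 - x2"
  shows "ec_add W (Affine x1 y1) (Affine x2 y2) = ec_neg W (Affine x3 (l * (x3 - x1) + y1))"
  using assms(1) by (simp add: assms(2,3) ec_slope_def Let_def)

lemma affine_in_ec_points [simp]: "Affine x y \<in> ec_points W \<longleftrightarrow> on_curve W x y"
  and Infinity_in_ec_points [simp]: "Infinity \<in> ec_points W"
  by (auto simp: ec_points_def)

lemma ec_neg_neg [simp]: "ec_neg W (ec_neg W P) = P"
  by (cases P) simp_all

lemma ec_neg_eq_iff [simp]: "ec_neg W P = ec_neg W Q \<longleftrightarrow> P = Q"
  by (metis ec_neg_neg)

lemma ec_neg_closed: "P \<in> ec_points W \<Longrightarrow> ec_neg W P \<in> ec_points W"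
  by (cases P) (auto simp: on_curve_def algebra_simps power2_eq_square)

lemma ec_add_Infinity [simp]: "ec_add W P Infinity = P"
  by (cases P) simp_all

lemma ec_add_eq_Infinity_iff: "ec_add W P Q = Infinity \<longleftrightarrow> Q = ec_neg W P"
  by (cases P; cases Q) (auto simp: Let_def)

text \<open>The difference of the two curve equations factors as \<open>(y2 - y1) (y2 + y1 + a1 x + a3)\<close>.\<close>

lemma same_xcoord:
  assumes "on_curve W x y1" "on_curve W x y2"
  shows "Affine x y2 = Affine x y1 \<or> Affine x y2 = ec_neg W (Affine x y1)"
proof -
  have "(y2 - y1) * (y2 - (- y1 - wa1 W * x - wa3 W)) = 0"
    using assms by (simp add: on_curve_def) Groebner_Basis.algebra
  then show ?thesis by auto
qed

lemma tangent_denominator: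
  assumes "on_curve W x y1" "on_curve W x y2" "Affine x y2 \<noteq> ec_neg W (Affine x y1)"
  shows "y2 = y1" "2 * y1 + wa1 W * x + wa3 W \<noteq> 0"
proof -
  show 1: "y2 = y1" using same_xcoord[OF assms(1,2)] assms(3) by auto
  show "2 * y1 + wa1 W * x + wa3 W \<noteq> 0"
  proof
    assume "2 * y1 + wa1 W * x + wa3 W = 0"
    then have "y1 = - y1 - wa1 W * x - wa3 W" by Groebner_Basis.algebra
    then show False using assms(3) 1 by simp
  qed
qed

text \<open>The second relation treats chords and tangents uniformly. For a tangent both sides vanish. For a
chord it is the difference of the curve equations at the two points, divided by \<open>x2 - x1\<close> once \<open>y2\<close>
has been eliminated by the first relation.\<close>

lemma ec_slope_relation:
  assumes P: "on_curve W x1 y1" and Q: "on_curve W x2 y2"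
    and ne: "Affine x2 y2 \<noteq> ec_neg W (Affine x1 y1)"
    and l: "l = ec_slope W x1 y1 x2 y2"
  shows "l * (x2 - x1) = y2 - y1"
    and "l * (2 * y1 + wa1 W * x1 + wa3 W) - (3 * x1^2 + 2 * wa2 W * x1 + wa4 W - wa1 W * y1)
      = (x2 - x1) * (wa2 W + 2 * x1 + x2 - (l^2 + wa1 W * l))"
proof -
  let ?d = "2 * y1 + wa1 W * x1 + wa3 W"
  let ?n = "3 * x1^2 + 2 * wa2 W * x1 + wa4 W - wa1 W * y1"
  show line: "l * (x2 - x1) = y2 - y1"
    using tangent_denominator(1)[of W x1 y1 y2] P Q ne by (cases "x1 = x2") (auto simp: l ec_slope_def)
  show "l * ?d - ?n = (x2 - x1) * (wa2 W + 2 * x1 + x2 - (l^2 + wa1 W * l))"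
  proof (cases "x1 = x2")
    case True
    then have "?d \<noteq> 0" using tangent_denominator(2)[of W x1 y1 y2] P Q ne by simp
    then show ?thesis using True by (simp add: l ec_slope_def)
  next
    case False
    have y2: "y2 = y1 + l * (x2 - x1)" using line by simp
    have "(x2 - x1) * (l * ?d - ?n - (x2 - x1) * (wa2 W + 2 * x1 + x2 - (l^2 + wa1 W * l))) = 0"
      using P Q unfolding on_curve_def y2 by Groebner_Basis.algebra
    then show ?thesis using False by auto
  qed
qed

text \<open>On the line, the curve equation becomes a cubic in \<open>x\<close>, whose third zero is the \<open>x\<close>-coordinate of
the sum. This is why sums lie on the curve.\<close>

lemma line_meets_curve:
  assumes P: "on_curve W x1 y1" and Q: "on_curve W x2 y2"
    and ne: "Affine x2 y2 \<noteq> ec_neg W (Affine x1 y1)"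
    and l: "l = ec_slope W x1 y1 x2 y2" and x3: "x3 = l^2 + wa1 W * l - wa2 W - x1 - x2"
    and y: "y = l * (x - x1) + y1"
  shows "x^3 + wa2 W * x^2 + wa4 W * x + wa6 W - (y^2 + wa1 W * x * y + wa3 W * y)
    = (x - x1) * (x - x2) * (x - x3)"
  using P ec_slope_relation(2)[OF P Q ne l] unfolding on_curve_def y x3 by Groebner_Basis.algebra

lemma ec_add_closed:
  assumes "P \<in> ec_points W" "Q \<in> ec_points W"
  shows "ec_add W P Q \<in> ec_points W"
proof (cases "P = Infinity \<or> Q = Infinity \<or> Q = ec_neg W P")
  case True
  then show ?thesis using assms by (auto simp: ec_add_eq_Infinity_iff[THEN iffD2])
next
  case False
  then obtain x1 y1 x2 y2 where PQ: "P = Affine x1 y1" "Q = Affine x2 y2"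
    by (cases P; cases Q) auto
  then have on: "on_curve W x1 y1" "on_curve W x2 y2" and ne: "Affine x2 y2 \<noteq> ec_neg W (Affine x1 y1)"
    using assms False by auto
  define l where "l = ec_slope W x1 y1 x2 y2"
  define x3 where "x3 = l^2 + wa1 W * l - wa2 W - x1 - x2"
  have "on_curve W x3 (l * (x3 - x1) + y1)"
    using line_meets_curve[OF on ne l_def x3_def refl, of x3] by (simp add: on_curve_def)
  then have "ec_neg W (Affine x3 (l * (x3 - x1) + y1)) \<in> ec_points W"
    by (intro ec_neg_closed) simp
  then show ?thesis by (simp only: PQ ec_add_affine[OF ne l_def x3_def])
qed

text \<open>The line through the two points does not depend on their order, and only its expression in terms
of a base point does.\<close>

lemma ec_add_commute:
  assumes "P \<in> ec_points W" "Q \<in> ec_points W"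
  shows "ec_add W P Q = ec_add W Q P"
proof (cases "P = Infinity \<or> Q = Infinity \<or> Q = ec_neg W P")
  case True
  then show ?thesis
    by (metis ec_add.simps(1) ec_add_Infinity ec_add_eq_Infinity_iff ec_neg_neg)
next
  case False
  then obtain x1 y1 x2 y2 where PQ: "P = Affine x1 y1" "Q = Affine x2 y2"
    by (cases P; cases Q) auto
  then have on: "on_curve W x1 y1" "on_curve W x2 y2" and ne: "Affine x2 y2 \<noteq> ec_neg W (Affine x1 y1)"
    using assms False by auto
  have ne': "Affine x1 y1 \<noteq> ec_neg W (Affine x2 y2)"
    using ne ec_neg_neg[of W "Affine x2 y2"] by metis
  define l where "l = ec_slope W x1 y1 x2 y2"
  define x3 where "x3 = l^2 + wa1 W * l - wa2 W - x1 - x2"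
  have line: "l * (x2 - x1) = y2 - y1" using ec_slope_relation(1)[OF on ne l_def] .
  have l': "l = ec_slope W x2 y2 x1 y1"
  proof (cases "x1 = x2")
    case True
    then show ?thesis using line by (simp add: l_def)
  next
    case False
    then show ?thesis by (simp add: l_def ec_slope_def divide_simps) (simp add: algebra_simps)
  qed
  have x3': "x3 = l^2 + wa1 W * l - wa2 W - x2 - x1" by (simp add: x3_def)
  have "l * (x3 - x1) + y1 = l * (x3 - x2) + y2" using line by Groebner_Basis.algebra
  then show ?thesis
    by (simp only: PQ ec_add_affine[OF ne l_def x3_def] ec_add_affine[OF ne' l' x3'])
qed

section \<open>Changes of coordinates\<close>

lemma change_point_eq_Infinity_iff [simp]: "change_point C P = Infinity \<longleftrightarrow> P = Infinity"
  by (cases C; cases P) simp_all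

lemma inj_change_point:
  assumes "cu C \<noteq> 0" shows "inj (change_point C)"
proof (rule injI)
  fix P Q assume "change_point C P = change_point C Q"
  then show "P = Q" using assms by (cases C; cases P; cases Q) auto
qed

lemma change_point_closed:
  assumes "cu C \<noteq> 0" "P \<in> ec_points W"
  shows "change_point C P \<in> ec_points (change_curve C W)"
  using assms on_curve_change[of "cu C" W] by (cases C; cases P) auto

lemma change_point_neg:
  assumes "cu C \<noteq> 0"
  shows "change_point C (ec_neg W P) = ec_neg (change_curve C W) (change_point C P)"
  using assms by (cases C; cases W; cases P) (auto simp: field_simps eval_nat_numeral)

text \<open>Under \<open>x = u^2 x' + r\<close>, \<open>y = u^3 y' + s u^2 x' + t\<close> a slope \<open>l'\<close> becomes \<open>u l' + s\<close>. For a tangent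
this follows from how its denominator and its numerator transform (facts \<open>d\<close> and \<open>n\<close>).\<close>

lemma change_point_slope:
  assumes u: "u \<noteq> 0"
    and P: "on_curve W x1 y1" and Q: "on_curve W x2 y2"
    and ne: "Affine x2 y2 \<noteq> ec_neg W (Affine x1 y1)"
    and P': "change_point (Coord_change u r s t) (Affine x1 y1) = Affine x1' y1'"
    and Q': "change_point (Coord_change u r s t) (Affine x2 y2) = Affine x2' y2'"
  shows "ec_slope W x1 y1 x2 y2 =
    u * ec_slope (change_curve (Coord_change u r s t) W) x1' y1' x2' y2' + s"
proof -
  obtain a1 a2 a3 a4 a6 where W: "W = Weierstrass a1 a2 a3 a4 a6" by (cases W)
  have x1: "x1 = u^2 * x1' + r" and y1: "y1 = u^3 * y1' + s * u^2 * x1' + t"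
    and x2: "x2 = u^2 * x2' + r" and y2: "y2 = u^3 * y2' + s * u^2 * x2' + t"
    using u P' Q' by auto
  show ?thesis
  proof (cases "x1' = x2'")
    case False
    then have "u^2 * (x2' - x1') \<noteq> 0" "x2' - x1' \<noteq> 0" using u by auto
    moreover have "x2 - x1 = u^2 * (x2' - x1')" "y2 - y1 = u^3 * (y2' - y1') + s * (u^2 * (x2' - x1'))"
      unfolding x1 x2 y1 y2 by Groebner_Basis.algebra+
    moreover have "x1 \<noteq> x2" using False u by (simp add: x1 x2)
    ultimately show ?thesis using False u
      by (simp add: ec_slope_def add_divide_distrib eval_nat_numeral)
  next
    case True
    then have x12: "x1 = x2" by (simp add: x1 x2)
    let ?d = "2 * y1 + a1 * x1 + a3" and ?n = "3 * x1^2 + 2 * a2 * x1 + a4 - a1 * y1"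
    let ?W' = "change_curve (Coord_change u r s t) W"
    let ?d' = "2 * y1' + wa1 ?W' * x1' + wa3 ?W'"
    let ?n' = "3 * x1'^2 + 2 * wa2 ?W' * x1' + wa4 ?W' - wa1 ?W' * y1'"
    have a': "u * wa1 ?W' = a1 + 2 * s" "u^2 * wa2 ?W' = a2 - s * a1 + 3 * r - s^2"
       "u^3 * wa3 ?W' = a3 + r * a1 + 2 * t"
       "u^4 * wa4 ?W' = a4 - s * a3 + 2 * r * a2 - (t + r * s) * a1 + 3 * r^2 - 2 * s * t"
      using u by (simp_all add: W)
    have "?d \<noteq> 0" using tangent_denominator(2)[of W x1 y1 y2] P Q ne x12 by (simp add: W)
    have d: "?d = u^3 * ?d'" using a'(1,3) unfolding x1 y1 by Groebner_Basis.algebra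
    have n: "?n = s * ?d + u^4 * ?n'"
      using a' unfolding x1 y1 by Groebner_Basis.algebra
    have "?n / ?d = s + u^4 * ?n' / (u^3 * ?d')"
      using \<open>?d \<noteq> 0\<close> unfolding n by (simp add: add_divide_distrib) (simp add: d)
    also have "u^4 * ?n' / (u^3 * ?d') = u * (?n' / ?d')"
      using u by (simp add: eval_nat_numeral)
    finally show ?thesis using True x12 by (simp add: ec_slope_def W del: change_curve.simps)
  qed
qed

text \<open>A change of coordinates maps lines to lines and fixes the point at infinity, so it respects the
chord-tangent law.\<close>

lemma change_point_add:
  assumes u: "cu C \<noteq> 0" and "P \<in> ec_points W" "Q \<in> ec_points W"
  shows "change_point C (ec_add W P Q) =
    ec_add (change_curve C W) (change_point C P) (change_point C Q)"
proof (cases "P = Infinity \<or> Q = Infinity \<or> Q = ec_neg W P")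
  case True
  then show ?thesis
  proof (elim disjE)
    assume "Q = ec_neg W P"
    then have "ec_add W P Q = Infinity" "ec_add (change_curve C W) (change_point C P) (change_point C Q) = Infinity"
      by (simp_all add: ec_add_eq_Infinity_iff change_point_neg[OF u])
    then show ?thesis by simp
  qed auto
next
  case False
  then obtain x1 y1 x2 y2 where PQ: "P = Affine x1 y1" "Q = Affine x2 y2"
    by (cases P; cases Q) auto
  then have on: "on_curve W x1 y1" "on_curve W x2 y2" and ne: "Affine x2 y2 \<noteq> ec_neg W (Affine x1 y1)"
    using assms False by auto
  obtain u r s t where C: "C = Coord_change u r s t" by (cases C)
  have u: "u \<noteq> 0" using u C by simp
  let ?W' = "change_curve C W"
  obtain x1' y1' x2' y2' where PQ': "change_point C P = Affine x1' y1'" "change_point C Q = Affine x2' y2'"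
    by (simp add: PQ C)
  have x1: "x1 = u^2 * x1' + r" and y1: "y1 = u^3 * y1' + s * u^2 * x1' + t"
    and x2: "x2 = u^2 * x2' + r" and y2: "y2 = u^3 * y2' + s * u^2 * x2' + t"
    using u PQ' by (auto simp: PQ C)
  have ne': "Affine x2' y2' \<noteq> ec_neg ?W' (Affine x1' y1')"
    using False PQ' injD[OF inj_change_point[OF assms(1)]] change_point_neg[OF assms(1)] by metis
  define l where "l = ec_slope W x1 y1 x2 y2"
  define x3 where "x3 = l^2 + wa1 W * l - wa2 W - x1 - x2"
  define l' where "l' = ec_slope ?W' x1' y1' x2' y2'"
  define x3' where "x3' = l'^2 + wa1 ?W' * l' - wa2 ?W' - x1' - x2'"
  have l: "l = u * l' + s"
    unfolding l_def l'_def C by (rule change_point_slope[OF u on ne]) (use PQ' PQ C in auto)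
  have a': "u * wa1 ?W' = wa1 W + 2 * s" "u^2 * wa2 ?W' = wa2 W - s * wa1 W + 3 * r - s^2"
    using u by (cases W; simp add: C)+
  have x3: "x3 = u^2 * x3' + r"
    using a' unfolding x3_def x3'_def l x1 x2 by Groebner_Basis.algebra
  have "l * (x3 - x1) + y1 = u^3 * (l' * (x3' - x1') + y1') + s * u^2 * x3' + t"
    unfolding x3 l x1 y1 by Groebner_Basis.algebra
  then have "change_point C (Affine x3 (l * (x3 - x1) + y1)) = Affine x3' (l' * (x3' - x1') + y1')"
    using u by (simp add: C x3)
  then show ?thesis
    unfolding PQ' unfolding PQ ec_add_affine[OF ne l_def x3_def] ec_add_affine[OF ne' l'_def x3'_def]
    by (simp only: change_point_neg[OF assms(1)])
qed

text \<open>The change of coordinates that induces negation on the points and maps the curve to itself.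
Through it, negation inherits additivity from \<open>change_point_add\<close>.\<close>

definition neg_change :: "'a::field weierstrass \<Rightarrow> 'a coord_change" where
  "neg_change W = Coord_change (- 1) 0 (- wa1 W) (- wa3 W)"

lemma ec_neg_add:
  assumes "P \<in> ec_points W" "Q \<in> ec_points W"
  shows "ec_neg W (ec_add W P Q) = ec_add W (ec_neg W P) (ec_neg W Q)"
proof -
  have "change_point (neg_change W) P = ec_neg W P" for P
    by (cases P) (auto simp: neg_change_def)
  moreover have "change_curve (neg_change W) W = W"
    by (cases W) (simp add: neg_change_def power2_eq_square algebra_simps)
  moreover have "cu (neg_change W) \<noteq> 0" by (simp add: neg_change_def)
  ultimately show ?thesis using change_point_add[OF _ assms, of "neg_change W"] by simp
qed

section \<open>The discriminant under changes of coordinates\<close>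

lemma change_curve_scale:
  assumes "u \<noteq> 0"
  shows "change_curve (Coord_change u r s t) W =
    change_curve (Coord_change u 0 0 0) (change_curve (Coord_change 1 r s t) W)"
  using assms by (cases W) simp

text \<open>The discriminant is homogeneous of weight 12 when \<open>ai\<close> has weight \<open>i\<close>.\<close>

lemma discriminant_scale:
  assumes "u \<noteq> 0"
  shows "u^12 * discriminant (change_curve (Coord_change u 0 0 0) W) = discriminant W"
proof -
  obtain a1 a2 a3 a4 a6 where W: "W = Weierstrass a1 a2 a3 a4 a6" by (cases W)
  define b1 b2 b3 b4 b6 where b: "b1 = a1 / u" "b2 = a2 / u^2" "b3 = a3 / u^3" "b4 = a4 / u^4" "b6 = a6 / u^6"
  have a: "a1 = u * b1" "a2 = u^2 * b2" "a3 = u^3 * b3" "a4 = u^4 * b4" "a6 = u^6 * b6"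
    using assms by (simp_all add: b)
  have "change_curve (Coord_change u 0 0 0) W = Weierstrass b1 b2 b3 b4 b6"
    by (simp add: W b)
  moreover have "u^12 * discriminant (Weierstrass b1 b2 b3 b4 b6) = discriminant W"
    unfolding W a discriminant_def Let_def weierstrass.sel by Groebner_Basis.algebra
  ultimately show ?thesis by simp
qed

text \<open>Only the quantities \<open>b2, b4, b6, b8\<close> enter the discriminant. They transform by the formulas
\<open>c2\<close> to \<open>c8\<close>, which contain \<open>r\<close> but neither \<open>s\<close> nor \<open>t\<close>.\<close>

lemma discriminant_translate:
  "discriminant (change_curve (Coord_change 1 r s t) W) = discriminant W"
proof -
  obtain a1 a2 a3 a4 a6 where W: "W = Weierstrass a1 a2 a3 a4 a6" by (cases W)
  let ?c1 = "a1 + 2 * s"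
  let ?c2 = "a2 - s * a1 + 3 * r - s^2"
  let ?c3 = "a3 + r * a1 + 2 * t"
  let ?c4 = "a4 - s * a3 + 2 * r * a2 - (t + r * s) * a1 + 3 * r^2 - 2 * s * t"
  let ?c6 = "a6 + r * a4 + r^2 * a2 + r^3 - t * a3 - t^2 - r * t * a1"
  define b2 b4 b6 b8 where b: "b2 = a1^2 + 4 * a2" "b4 = 2 * a4 + a1 * a3" "b6 = a3^2 + 4 * a6"
    "b8 = a1^2 * a6 + 4 * a2 * a6 - a1 * a3 * a4 + a2 * a3^2 - a4^2"
  have c2: "?c1^2 + 4 * ?c2 = b2 + 12 * r"
    unfolding b by Groebner_Basis.algebra
  have c4: "2 * ?c4 + ?c1 * ?c3 = b4 + r * b2 + 6 * r^2"
    unfolding b by Groebner_Basis.algebra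
  have c6: "?c3^2 + 4 * ?c6 = b6 + 2 * r * b4 + r^2 * b2 + 4 * r^3"
    unfolding b by Groebner_Basis.algebra
  have c8: "?c1^2 * ?c6 + 4 * ?c2 * ?c6 - ?c1 * ?c3 * ?c4 + ?c2 * ?c3^2 - ?c4^2 =
      b8 + 3 * r * b6 + 3 * r^2 * b4 + r^3 * b2 + 3 * r^4"
    unfolding b by Groebner_Basis.algebra
  have b8: "4 * b8 = b2 * b6 - b4^2" unfolding b by Groebner_Basis.algebra
  have "discriminant (change_curve (Coord_change 1 r s t) W) =
    - ((b2 + 12 * r)^2 * (b8 + 3 * r * b6 + 3 * r^2 * b4 + r^3 * b2 + 3 * r^4))
    - 8 * (b4 + r * b2 + 6 * r^2)^3 - 27 * (b6 + 2 * r * b4 + r^2 * b2 + 4 * r^3)^2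
    + 9 * (b2 + 12 * r) * (b4 + r * b2 + 6 * r^2) * (b6 + 2 * r * b4 + r^2 * b2 + 4 * r^3)"
    unfolding W discriminant_def Let_def
    by (simp only: change_curve.simps weierstrass.sel power_one div_by_1 c2 c4 c6 c8)
  \<comment> \<open>The terms in \<open>r\<close> add up to a multiple of the relation \<open>b8\<close>; the cofactor can be read off
    from the part that is linear in the variable \<open>b8\<close>.\<close>
  also have "\<dots> = - (b2 ^ 2 * b8) - 8 * b4 ^ 3 - 27 * b6 ^ 2 + 9 * b2 * b4 * b6
      - (6 * b2 * r + 36 * r^2) * (4 * b8 - (b2 * b6 - b4^2))"
    by Groebner_Basis.algebra
  also have "\<dots> = - (b2 ^ 2 * b8) - 8 * b4 ^ 3 - 27 * b6 ^ 2 + 9 * b2 * b4 * b6"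
    unfolding b8 by simp
  also have "\<dots> = discriminant W"
    by (simp add: W discriminant_def Let_def b)
  finally show ?thesis .
qed

lemma elliptic_curve_change_curve:
  assumes "cu C \<noteq> 0" and "elliptic_curve W"
  shows "elliptic_curve (change_curve C W)"
proof -
  obtain u r s t where C: "C = Coord_change u r s t" by (cases C)
  have u: "u \<noteq> 0" using assms(1) by (simp add: C)
  have "u^12 * discriminant (change_curve C W) = discriminant W"
    unfolding C change_curve_scale[OF u, of r s t W] discriminant_scale[OF u] discriminant_translate ..
  then show ?thesis using assms(2) unfolding elliptic_curve_def by auto
qed

lemma discriminant_two_torsion_form:
  "discriminant (Weierstrass 0 g 0 b 0) = 16 * b^2 * (g^2 - 4 * b)"
  by (simp add: discriminant_def power2_eq_square power3_eq_cube algebra_simps)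

section \<open>Points of order four\<close>

lemma ec_group_simps [simp]:
  "carrier (ec_group W) = ec_points W" "P \<otimes>\<^bsub>ec_group W\<^esub> Q = ec_add W P Q"
  "\<one>\<^bsub>ec_group W\<^esub> = Infinity"
  by (simp_all add: ec_group_def)

lemma ec_group_inv:
  assumes "P \<in> ec_points W"
  shows "inv\<^bsub>ec_group W\<^esub> P = ec_neg W P"
  unfolding m_inv_def ec_group_simps ec_add_eq_Infinity_iff
  using ec_neg_closed[OF assms] by (intro the_equality) (simp, blast)

lemma ec_group_square: "P [^]\<^bsub>ec_group W\<^esub> (2::nat) = ec_add W P P"
  unfolding nat_pow_def numeral_2_eq_2 by simp

context
  fixes W :: "'a::field weierstrass" and R T :: "'a ec_point"
  assumes order: "has_order (ec_group W) R 4"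
  defines "T \<equiv> ec_add W R R"
begin

text \<open>The power \<open>4R\<close> is bracketed as \<open>(T + R) + R\<close>, so its vanishing says directly that \<open>T + R = -R\<close>.\<close>

lemma order_four_basics:
  shows "R \<in> ec_points W" "T \<in> ec_points W" "R \<noteq> Infinity" "T \<noteq> Infinity"
    and "ec_neg W R \<noteq> R" "ec_add W T R = ec_neg W R"
proof -
  show R: "R \<in> ec_points W" using order by (simp add: has_order_def)
  then show "T \<in> ec_points W" by (simp add: T_def ec_add_closed)
  have pow: "R [^]\<^bsub>ec_group W\<^esub> m \<noteq> Infinity" if "0 < m" "m < 4" for m :: nat
    using order that by (simp add: has_order_def)
  show "R \<noteq> Infinity" using pow[of 1] unfolding nat_pow_def by simp
  show "T \<noteq> Infinity" using pow[of 2] by (simp add: ec_group_square T_def)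
  then show "ec_neg W R \<noteq> R" by (auto simp: T_def ec_add_eq_Infinity_iff)
  have "R [^]\<^bsub>ec_group W\<^esub> (4::nat) = ec_add W (ec_add W T R) R"
    unfolding nat_pow_def eval_nat_numeral T_def by simp
  then have "ec_add W (ec_add W T R) R = Infinity" using order by (simp add: has_order_def)
  then show "ec_add W T R = ec_neg W R" by (metis ec_add_eq_Infinity_iff ec_neg_neg)
qed

lemma order_four_double_neq: "T \<noteq> R" "T \<noteq> ec_neg W R"
  using order_four_basics T_def ec_add_eq_Infinity_iff ec_neg_neg ec_neg_eq_iff
    ec_neg.simps(1) by metis+

text \<open>The line through \<open>R\<close> and \<open>T\<close> meets the curve a third time in \<open>-(T + R) = R\<close>, so it is the tangent at
\<open>R\<close>. The third point on that tangent is \<open>-2R = -T\<close>. Hence \<open>T\<close> and \<open>-T\<close> lie on the same line and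
have the same \<open>x\<close>, and since the line is not vertical they are equal.\<close>

lemma order_four_neg_double: "ec_neg W T = T"
proof -
  obtain x y where R: "R = Affine x y" using order_four_basics by (cases R) auto
  obtain e f where T: "T = Affine e f" using order_four_basics by (cases T) auto
  have on: "on_curve W x y" "on_curve W e f"
    using order_four_basics(1,2) by (simp_all add: R T)
  \<comment> \<open>The chord through \<open>R\<close> and \<open>T\<close> is a proper chord.\<close>
  have "e \<noteq> x"
    using same_xcoord[of W x y f] on order_four_double_neq by (auto simp: R T)
  have ne: "Affine e f \<noteq> ec_neg W (Affine x y)"
    using order_four_double_neq by (simp add: R T)
  define l where "l = ec_slope W x y e f"
  define x3 where "x3 = l^2 + wa1 W * l - wa2 W - x - e"
  have "ec_add W R T = ec_neg W R"
    using order_four_basics ec_add_commute by metis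
  then have "Affine x3 (l * (x3 - x) + y) = R"
    unfolding R T ec_add_affine[OF ne l_def x3_def] by simp
  then have "x3 = x" by (simp add: R)
  then have sum: "l^2 + wa1 W * l = wa2 W + 2 * x + e" by (simp add: x3_def algebra_simps)
  have l: "l * (2 * y + wa1 W * x + wa3 W) = 3 * x^2 + 2 * wa2 W * x + wa4 W - wa1 W * y"
    using ec_slope_relation(2)[OF on(1,2) ne l_def] unfolding sum by simp
  have neR: "Affine x y \<noteq> ec_neg W (Affine x y)" using order_four_basics(5) by (simp add: R)
  then have "2 * y + wa1 W * x + wa3 W \<noteq> 0"
    using tangent_denominator(2) on by blast
  then have l2: "l = ec_slope W x y x y"
    using l by (simp add: ec_slope_def divide_simps)
  have e: "e = l^2 + wa1 W * l - wa2 W - x - x" using sum by (simp add: algebra_simps)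
  have "T = ec_neg W (Affine e (l * (e - x) + y))"
    unfolding T_def unfolding R by (rule ec_add_affine[OF neR l2 e])
  moreover have "l * (e - x) + y = f"
    using ec_slope_relation(1)[OF on ne l_def] by simp
  ultimately show ?thesis by (simp add: T)
qed

lemma order_four_generate: "generate (ec_group W) {R} = {Infinity, R, T, ec_neg W R}"
proof
  note R = order_four_basics(1)
  have inv: "inv\<^bsub>ec_group W\<^esub> R = ec_neg W R" using ec_group_inv[OF R] .
  have TT: "ec_add W T T = Infinity"
    using order_four_neg_double by (simp add: ec_add_eq_Infinity_iff)
  have RT: "ec_add W R T = ec_neg W R"
    using order_four_basics ec_add_commute by metis
  have NN: "ec_add W (ec_neg W R) (ec_neg W R) = T"
    using ec_neg_add[OF R R] order_four_neg_double by (simp add: T_def)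
  have TN: "ec_add W T (ec_neg W R) = R"
    using ec_neg_add[OF order_four_basics(2) R] order_four_basics(6) order_four_neg_double by simp
  have NT: "ec_add W (ec_neg W R) T = R"
    using TN ec_add_commute order_four_basics(2) ec_neg_closed[OF R] by metis
  have RN: "ec_add W R (ec_neg W R) = Infinity" "ec_add W (ec_neg W R) R = Infinity"
    by (simp_all add: ec_add_eq_Infinity_iff)
  show "generate (ec_group W) {R} \<subseteq> {Infinity, R, T, ec_neg W R}"
  proof
    fix P assume "P \<in> generate (ec_group W) {R}"
    then show "P \<in> {Infinity, R, T, ec_neg W R}"
    proof induction
      case (eng P Q)
      then show ?case
        using TT RT NN TN NT RN order_four_basics(6) T_def by auto
    qed (auto simp: inv)
  qed
  have "T \<in> generate (ec_group W) {R}"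
    using generate.eng[OF generate.incl generate.incl, of R "{R}" R "ec_group W"] by (simp add: T_def)
  moreover have "ec_neg W R \<in> generate (ec_group W) {R}"
    using generate.inv[of R "{R}" "ec_group W"] by (simp add: inv)
  moreover have "Infinity \<in> generate (ec_group W) {R}"
    using generate.one[of "ec_group W" "{R}"] by simp
  ultimately show "{Infinity, R, T, ec_neg W R} \<subseteq> generate (ec_group W) {R}"
    using generate.incl[of R "{R}" "ec_group W"] by simp
qed

end

section \<open>Duplication and the normal form\<close>

text \<open>The third point \<open>(0, 0)\<close> lies on the tangent at \<open>(p, y)\<close>, so this tangent has equation \<open>y = l x\<close>.
The sum of the roots gives \<open>l^2 = g + 2 p\<close>, and the curve equation at \<open>p\<close> then gives \<open>b = p^2\<close>.\<close>

lemma double_is_origin: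
  assumes on: "on_curve (Weierstrass 0 g 0 b 0) p y"
    and double: "ec_add (Weierstrass 0 g 0 b 0) (Affine p y) (Affine p y) = Affine 0 0"
  shows "p \<noteq> 0" "b = p^2"
proof -
  let ?W = "Weierstrass 0 g 0 b 0"
  have ne: "Affine p y \<noteq> ec_neg ?W (Affine p y)"
    using double by (metis ec_add_eq_Infinity_iff ec_point.distinct(1))
  define l where "l = ec_slope ?W p y p y"
  define x3 where "x3 = l^2 + wa1 ?W * l - wa2 ?W - p - p"
  have "ec_neg ?W (Affine x3 (l * (x3 - p) + y)) = Affine 0 0"
    using double unfolding ec_add_affine[OF ne l_def x3_def] .
  then have x3: "x3 = 0" and y: "y = l * p" by (auto simp: algebra_simps)
  have l: "l^2 = g + 2 * p" using x3 by (simp add: x3_def algebra_simps)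
  have "y \<noteq> - y" using ne by simp
  then show p: "p \<noteq> 0" using y by auto
  have "l^2 * p^2 = p^3 + g * p^2 + b * p"
    using on by (simp add: on_curve_def y power_mult_distrib)
  then have "p * (b - p^2) = 0" unfolding l by Groebner_Basis.algebra
  then show "b = p^2" using p by simp
qed

text \<open>The curve equation eliminates \<open>y\<close> from the square of the tangent slope, so that \<open>x(2P)\<close> is rational
in \<open>x(P)\<close>.\<close>

lemma double_xcoord:
  assumes on: "on_curve (Weierstrass 0 a 0 b c) x y"
    and double: "ec_add (Weierstrass 0 a 0 b c) (Affine x y) (Affine x y) = Affine e f"
  shows "e = (3 * x^2 + 2 * a * x + b)^2 / (4 * (x^3 + a * x^2 + b * x + c)) - a - 2 * x"
proof -
  let ?W = "Weierstrass 0 a 0 b c"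
  have ne: "Affine x y \<noteq> ec_neg ?W (Affine x y)"
    using double by (metis ec_add_eq_Infinity_iff ec_point.distinct(1))
  define l where "l = ec_slope ?W x y x y"
  define x3 where "x3 = l^2 + wa1 ?W * l - wa2 ?W - x - x"
  have "ec_neg ?W (Affine x3 (l * (x3 - x) + y)) = Affine e f"
    using double unfolding ec_add_affine[OF ne l_def x3_def] .
  then have "e = l^2 - a - 2 * x" by (simp add: x3_def)
  moreover have "l^2 = (3 * x^2 + 2 * a * x + b)^2 / (4 * y^2)"
    by (simp add: l_def ec_slope_def power_divide power_mult_distrib)
  moreover have "y^2 = x^3 + a * x^2 + b * x + c" using on by (simp add: on_curve_def)
  ultimately show ?thesis by simp
qed

lemma change_translate:
  fixes u r s t e :: "'a::field"
  assumes "u \<noteq> 0"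
  defines "C' \<equiv> Coord_change u (r + u^2 * e) s (t + s * u^2 * e)"
  shows "change_curve C' W = change_curve (Coord_change 1 e 0 0) (change_curve (Coord_change u r s t) W)"
    and "change_point C' P = change_point (Coord_change 1 e 0 0) (change_point (Coord_change u r s t) P)"
proof -
  show "change_point C' P = change_point (Coord_change 1 e 0 0) (change_point (Coord_change u r s t) P)"
    using assms by (cases P) (auto simp: field_simps eval_nat_numeral)
  show "change_curve C' W = change_curve (Coord_change 1 e 0 0) (change_curve (Coord_change u r s t) W)"
    using assms(1) unfolding C'_def
    by (cases W) (auto simp: field_simps eval_nat_numeral)
qed

section \<open>Field embeddings and the chord-tangent law\<close>

locale field_embedding =
  fixes h :: "'a::field \<Rightarrow> 'b::field"
  assumes hom_add: "h (x + y) = h x + h y"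
    and hom_mult: "h (x * y) = h x * h y"
    and hom_one: "h 1 = 1"
begin

lemma hom_zero: "h 0 = 0"
proof -
  have "h 0 + h 0 = h 0 + 0" using hom_add[of 0 0] by simp
  then show ?thesis by (rule add_left_imp_eq)
qed

lemma hom_minus: "h (- x) = - h x"
  using hom_add[of x "- x"] hom_zero by (simp add: minus_unique)

lemma hom_diff: "h (x - y) = h x - h y"
  using hom_add[of x "- y"] hom_minus by simp

lemma hom_eq_0_iff: "h x = 0 \<longleftrightarrow> x = 0"
proof
  assume "h x = 0"
  then show "x = 0" using hom_mult[of x "inverse x"] hom_one by (cases "x = 0") auto
qed (simp add: hom_zero)

lemma hom_eq_iff: "h x = h y \<longleftrightarrow> x = y"
  using hom_eq_0_iff[of "x - y"] by (simp add: hom_diff)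

lemma hom_divide: "h (x / y) = h x / h y"
proof (cases "y = 0")
  case False
  then have "h (x / y) * h y = h x" by (simp flip: hom_mult)
  then show ?thesis using False by (simp add: hom_eq_0_iff eq_divide_eq)
qed (simp add: hom_zero)

lemma hom_power: "h (x ^ n) = h x ^ n"
  by (induction n) (simp_all add: hom_one hom_mult)

lemma hom_numeral: "h (numeral n) = numeral n"
  by (induction n) (simp_all only: numeral.simps hom_add hom_one)

lemmas hom_simps = hom_zero hom_one hom_add hom_mult hom_minus hom_diff hom_divide
  hom_power hom_numeral hom_eq_iff hom_eq_0_iff

lemma on_curve_hom: "on_curve (map_weierstrass h W) (h x) (h y) \<longleftrightarrow> on_curve W x y"
  by (simp add: on_curve_def weierstrass.map_sel flip: hom_add hom_mult hom_power) (simp add: hom_eq_iff)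

lemma ec_neg_hom: "map_ec_point h (ec_neg W P) = ec_neg (map_weierstrass h W) (map_ec_point h P)"
  by (cases P) (simp_all add: weierstrass.map_sel hom_simps)

lemma map_ec_point_eq_iff: "map_ec_point h P = map_ec_point h Q \<longleftrightarrow> P = Q"
  by (cases P; cases Q) (simp_all add: hom_eq_iff)

lemma ec_slope_hom:
  "h (ec_slope W x1 y1 x2 y2) = ec_slope (map_weierstrass h W) (h x1) (h y1) (h x2) (h y2)"
  by (simp add: ec_slope_def weierstrass.map_sel hom_simps)

lemma ec_add_hom:
  "map_ec_point h (ec_add W P Q) =
    ec_add (map_weierstrass h W) (map_ec_point h P) (map_ec_point h Q)"
proof (cases "P = Infinity \<or> Q = Infinity \<or> Q = ec_neg W P")
  case True
  then have "ec_add W P Q = Infinity \<and> ec_add (map_weierstrass h W) (map_ec_point h P) (map_ec_point h Q) = Infinity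
      \<or> P = Infinity \<or> Q = Infinity"
    by (auto simp: ec_add_eq_Infinity_iff ec_neg_hom)
  then show ?thesis by auto
next
  case False
  then obtain x1 y1 x2 y2 where PQ: "P = Affine x1 y1" "Q = Affine x2 y2"
    by (cases P; cases Q) auto
  have ne: "Affine x2 y2 \<noteq> ec_neg W (Affine x1 y1)" using False PQ by simp
  then have ne': "Affine (h x2) (h y2) \<noteq> ec_neg (map_weierstrass h W) (Affine (h x1) (h y1))"
    using ec_neg_hom[of W P] map_ec_point_eq_iff[of Q "ec_neg W P"] PQ by simp
  show ?thesis
    unfolding PQ ec_point.map ec_add_affine[OF ne refl refl] ec_add_affine[OF ne' refl refl] ec_neg_hom
    by (simp add: hom_simps ec_slope_hom weierstrass.map_sel)
qed

lemma change_point_hom: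
  "map_ec_point h (change_point C P) = change_point (map_coord_change h C) (map_ec_point h P)"
  by (cases C; cases P) (simp_all add: hom_simps)

lemma change_curve_hom:
  "map_weierstrass h (change_curve C W) = change_curve (map_coord_change h C) (map_weierstrass h W)"
  by (cases C; cases W) (simp add: hom_simps)

end

section \<open>The Galois action on a point of order four\<close>

interpretation to_ac: field_embedding to_ac
  by unfold_locales simp_all

lemma Gal_Qbar_field_embedding:
  assumes "\<sigma> \<in> Gal_Qbar"
  shows "field_embedding \<sigma>" and "\<sigma> (to_ac q) = to_ac q"
proof -
  have add: "\<And>x y. \<sigma> (x + y) = \<sigma> x + \<sigma> y" and mult: "\<And>x y. \<sigma> (x * y) = \<sigma> x * \<sigma> y"
    and fix_base: "\<And>q. \<sigma> (to_ac q) = to_ac q"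
    using assms by (auto simp: Gal_Qbar_def)
  show "\<sigma> (to_ac q) = to_ac q" by (rule fix_base)
  show "field_embedding \<sigma>"
    using add mult fix_base[of 1] by unfold_locales simp_all
qed

lemma Gal_Qbar_fixes_base:
  assumes "\<sigma> \<in> Gal_Qbar"
  shows "map_weierstrass \<sigma> (map_weierstrass to_ac E) = map_weierstrass to_ac E"
    and "map_coord_change \<sigma> (map_coord_change to_ac C) = map_coord_change to_ac C"
  using Gal_Qbar_field_embedding(2)[OF assms]
  by (simp_all add: weierstrass.map_comp coord_change.map_comp comp_def)

lemma fixed_field_Gal_Qbar: "(\<forall>\<sigma>\<in>Gal_Qbar. \<sigma> x = x) \<longleftrightarrow> x \<in> \<rat>"
  using Gal_Qbar_moves_irrational[of x] Gal_Qbar_field_embedding(2)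
  unfolding Rats_alg_closure by blast

text \<open>The image of \<open>R\<close> is not \<open>O\<close>, and it is not \<open>T\<close> because \<open>T = -T\<close> while \<open>R \<noteq> -R\<close>. Conversely,
\<open>\<sigma>R = \<plusminus>R\<close> implies \<open>\<sigma>T = T\<close>, since \<open>-R - R = -T = T\<close>.\<close>

lemma galois_stable_iff_conjugates_pm:
  fixes E :: "rat weierstrass"
  assumes order: "has_order (ec_group_Qbar E) R 4"
  shows "galois_stable (generate (ec_group_Qbar E) {R}) \<longleftrightarrow>
    (\<forall>\<sigma>\<in>Gal_Qbar. map_ec_point \<sigma> R \<in> {R, ec_neg (map_weierstrass to_ac E) R})"
proof -
  let ?W = "map_weierstrass to_ac E"
  define T where "T = ec_add ?W R R"
  note R = order_four_basics[OF order, folded T_def] order_four_neg_double[OF order, folded T_def]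
  have gen: "generate (ec_group ?W) {R} = {Infinity, R, T, ec_neg ?W R}"
    unfolding T_def by (rule order_four_generate[OF order])
  have "map_ec_point \<sigma> ` {Infinity, R, T, ec_neg ?W R} = {Infinity, R, T, ec_neg ?W R} \<longleftrightarrow>
    map_ec_point \<sigma> R \<in> {R, ec_neg ?W R}" if \<sigma>: "\<sigma> \<in> Gal_Qbar" for \<sigma>
  proof -
    interpret field_embedding \<sigma> by (rule Gal_Qbar_field_embedding[OF \<sigma>])
    let ?s = "map_ec_point \<sigma>"
    have neg: "?s (ec_neg ?W P) = ec_neg ?W (?s P)" for P
      using ec_neg_hom[of ?W P] by (simp add: Gal_Qbar_fixes_base[OF \<sigma>])
    have add: "?s (ec_add ?W P Q) = ec_add ?W (?s P) (?s Q)" for P Q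
      using ec_add_hom[of ?W P Q] by (simp add: Gal_Qbar_fixes_base[OF \<sigma>])
    have "?s R \<noteq> Infinity" using R(3) by (cases R) simp_all
    moreover have "?s R \<noteq> T"
    proof
      assume "?s R = T"
      then have "?s (ec_neg ?W R) = ?s R" using R(7) by (simp add: neg)
      then show False using R(5) by (simp add: map_ec_point_eq_iff)
    qed
    moreover have "?s T = T" if "?s R \<in> {R, ec_neg ?W R}"
    proof -
      have "ec_add ?W (ec_neg ?W R) (ec_neg ?W R) = T"
        using ec_neg_add[OF R(1) R(1)] R(7) by (simp add: T_def)
      then show ?thesis using that by (auto simp: T_def add)
    qed
    moreover have "?s Infinity = Infinity" by simp
    ultimately show ?thesis
    proof (intro iffI)
      assume "?s ` {Infinity, R, T, ec_neg ?W R} = {Infinity, R, T, ec_neg ?W R}"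
      then have "?s R \<in> {Infinity, R, T, ec_neg ?W R}" by blast
      then show "?s R \<in> {R, ec_neg ?W R}"
        using \<open>?s R \<noteq> Infinity\<close> \<open>?s R \<noteq> T\<close> by simp
    qed (auto simp: neg)
  qed
  then show ?thesis unfolding galois_stable_def gen by blast
qed

text \<open>The change of coordinates has rational coefficients and so commutes with \<open>\<sigma>\<close>. In the model
\<open>y^2 = cubic\<close> the points \<open>\<plusminus>R\<close> are all the points with the \<open>x\<close>-coordinate of \<open>R\<close>, so
\<open>\<sigma>R = \<plusminus>R\<close> amounts to \<open>\<sigma>x = x\<close>.\<close>

lemma conjugates_pm_iff_rational_xcoord:
  fixes E M :: "rat weierstrass"
  assumes R: "R \<in> ec_points (map_weierstrass to_ac E)" "R \<noteq> Infinity"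
    and model: "is_model E C M"
  shows "(\<forall>\<sigma>\<in>Gal_Qbar. map_ec_point \<sigma> R \<in> {R, ec_neg (map_weierstrass to_ac E) R}) \<longleftrightarrow>
    xcoord (change_point_Qbar C R) \<in> \<rat>"
proof -
  let ?W = "map_weierstrass to_ac E" and ?C = "map_coord_change to_ac C"
    and ?M = "map_weierstrass to_ac M"
  have u: "cu ?C \<noteq> 0" and M: "?M = change_curve ?C ?W" and M0: "wa1 ?M = 0" "wa3 ?M = 0"
    using model by (auto simp: is_model_def coord_change.map_sel weierstrass.map_sel to_ac.change_curve_hom)
  obtain x y where xy: "change_point ?C R = Affine x y"
    using R(2) by (cases "change_point ?C R") simp_all
  have on: "on_curve ?M x y" using change_point_closed[OF u R(1)] by (simp add: M xy)
  have "map_ec_point \<sigma> R \<in> {R, ec_neg ?W R} \<longleftrightarrow> \<sigma> x = x" if \<sigma>: "\<sigma> \<in> Gal_Qbar" for \<sigma>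
  proof -
    interpret field_embedding \<sigma> by (rule Gal_Qbar_field_embedding[OF \<sigma>])
    have on': "on_curve ?M (\<sigma> x) (\<sigma> y)"
      using on on_curve_hom[of ?M x y] by (simp add: Gal_Qbar_fixes_base[OF \<sigma>])
    have "map_ec_point \<sigma> R \<in> {R, ec_neg ?W R} \<longleftrightarrow>
        change_point ?C (map_ec_point \<sigma> R) \<in> {change_point ?C R, change_point ?C (ec_neg ?W R)}"
      using inj_change_point[OF u] by (auto simp: inj_eq)
    also have "\<dots> \<longleftrightarrow> Affine (\<sigma> x) (\<sigma> y) \<in> {Affine x y, ec_neg ?M (Affine x y)}"
      using change_point_hom[of ?C R]
      by (simp add: Gal_Qbar_fixes_base[OF \<sigma>] change_point_neg[OF u] M xy)
    also have "\<dots> \<longleftrightarrow> \<sigma> x = x"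
      using same_xcoord[of ?M x y "\<sigma> y"] on on' by auto
    finally show ?thesis .
  qed
  then show ?thesis by (simp add: xy fixed_field_Gal_Qbar)
qed

lemma has_order_change_point:
  assumes u: "cu C \<noteq> 0" and order: "has_order (ec_group W) R n"
  shows "has_order (ec_group (change_curve C W)) (change_point C R) n"
proof -
  let ?W' = "change_curve C W"
  have R: "R \<in> ec_points W" using order by (simp add: has_order_def)
  have pow: "change_point C (R [^]\<^bsub>ec_group W\<^esub> m) = change_point C R [^]\<^bsub>ec_group ?W'\<^esub> m
      \<and> R [^]\<^bsub>ec_group W\<^esub> m \<in> ec_points W" for m :: nat
    by (induction m) (simp_all add: nat_pow_def change_point_add[OF u _ R] ec_add_closed R)
  have "change_point C R [^]\<^bsub>ec_group ?W'\<^esub> m = Infinity \<longleftrightarrow> R [^]\<^bsub>ec_group W\<^esub> m = Infinity" for m :: nat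
    using pow[of m] by (metis change_point_eq_Infinity_iff)
  then show ?thesis
    using order change_point_closed[OF u R] by (simp add: has_order_def)
qed

text \<open>The new model is the given one shifted by \<open>e = x(2R)\<close>, so that \<open>2R\<close> becomes the origin, and \<open>\<delta>\<close>
is the new \<open>x\<close>-coordinate \<open>x(R) - e\<close>.\<close>

lemma rational_xcoord_imp_normal_form:
  fixes E M :: "rat weierstrass"
  assumes ell: "elliptic_curve E"
    and order: "has_order (ec_group_Qbar E) R 4"
    and model: "is_model E C M"
    and rat: "xcoord (change_point_Qbar C R) \<in> \<rat>"
  shows "\<exists>\<gamma> \<delta> :: rat. \<exists>C' :: rat coord_change.
           \<delta> \<noteq> 0 \<and> \<gamma>^2 - 4 * \<delta>^2 \<noteq> 0 \<and>
           is_model E C' (Weierstrass 0 \<gamma> 0 (\<delta>^2) 0) \<and>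
           xcoord (change_point_Qbar C' R) = to_ac \<delta> \<and>
           ec_add (map_weierstrass to_ac (Weierstrass 0 \<gamma> 0 (\<delta>^2) 0))
             (change_point_Qbar C' R) (change_point_Qbar C' R) = Affine 0 0"
proof -
  let ?C = "map_coord_change to_ac C" and ?W = "map_weierstrass to_ac E"
  obtain u r s t where C: "C = Coord_change u r s t" by (cases C)
  have u0: "u \<noteq> 0" and M: "M = change_curve C E" and M0: "wa1 M = 0" "wa3 M = 0"
    using model by (simp_all add: is_model_def C)
  obtain a b c where Mabc: "M = Weierstrass 0 a 0 b c"
    using M0 by (cases M) simp
  let ?M = "Weierstrass 0 (to_ac a) 0 (to_ac b) (to_ac c)"
  have WM: "change_curve ?C ?W = ?M"
    using Mabc M by (simp flip: to_ac.change_curve_hom)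
  have orderM: "has_order (ec_group ?M) (change_point ?C R) 4"
    using has_order_change_point[OF _ order, of ?C] u0 unfolding WM by (simp add: C)
  obtain x y where R': "change_point ?C R = Affine x y"
    using order_four_basics(3)[OF orderM] by (cases "change_point ?C R") simp_all
  note orderM = orderM[unfolded R']
  obtain e f where T: "ec_add ?M (Affine x y) (Affine x y) = Affine e f"
    using order_four_basics(4)[OF orderM] by (cases "ec_add ?M (Affine x y) (Affine x y)") simp_all
  have on: "on_curve ?M x y" using order_four_basics(1)[OF orderM] by simp
  have "f = - f" using order_four_neg_double[OF orderM] unfolding T by simp
  then have f: "f = 0" by simp
  have "x \<in> \<rat>" using rat by (simp add: R')
  moreover have "to_ac q \<in> \<rat>" for q :: rat by (simp add: Rats_alg_closure)
  ultimately have "e \<in> \<rat>" unfolding double_xcoord[OF on T]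
    by (intro Rats_diff Rats_divide Rats_add Rats_mult Rats_power Rats_number_of)
  then obtain e0 where e: "e = to_ac e0" by (auto simp: Rats_alg_closure)
  obtain x0 where x: "x = to_ac x0" using \<open>x \<in> \<rat>\<close> by (auto simp: Rats_alg_closure)
  \<comment> \<open>\<open>C\<close> followed by the translation \<open>x = x' + e0\<close>, written as a single substitution.\<close>
  define C' where "C' = Coord_change u (r + u^2 * e0) s (t + s * u^2 * e0)"
  let ?C' = "map_coord_change to_ac C'"
  let ?D = "Coord_change 1 e 0 0"
  obtain a' b' c' where M': "change_curve C' E = Weierstrass 0 a' 0 b' c'"
    unfolding C'_def change_translate(1)[OF u0] M[unfolded C, symmetric] Mabc by simp
  have C'D: "change_point ?C' P = change_point ?D (change_point ?C P)" for P
    using change_translate(2)[of "to_ac u" "to_ac r" e "to_ac s" "to_ac t" P] u0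
    by (simp add: C'_def C e)
  have M'D: "change_curve ?D ?M = Weierstrass 0 (to_ac a') 0 (to_ac b') (to_ac c')"
  proof -
    have "change_curve ?C' ?W = change_curve ?D (change_curve ?C ?W)"
      using change_translate(1)[of "to_ac u" "to_ac r" e "to_ac s" "to_ac t" ?W] u0
      by (simp add: C'_def C e)
    then show ?thesis unfolding WM using M' by (simp flip: to_ac.change_curve_hom)
  qed
  have xe: "change_point ?C' R = Affine (to_ac (x0 - e0)) y"
    by (simp add: C'D R' x e)
  have points: "Affine x y \<in> ec_points ?M" using on by simp
  have double: "ec_add (Weierstrass 0 (to_ac a') 0 (to_ac b') (to_ac c'))
      (Affine (to_ac (x0 - e0)) y) (Affine (to_ac (x0 - e0)) y) = Affine 0 0"
    using change_point_add[OF _ points points, of ?D] unfolding T M'D by (simp add: x e f del: ec_add.simps)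
  have on': "on_curve (Weierstrass 0 (to_ac a') 0 (to_ac b') (to_ac c')) (to_ac (x0 - e0)) y"
    using change_point_closed[OF _ points, of ?D] unfolding M'D by (simp add: x e)
  have "Affine 0 0 \<in> ec_points (Weierstrass 0 (to_ac a') 0 (to_ac b') (to_ac c'))"
    using ec_add_closed[of "Affine (to_ac (x0 - e0)) y" _ "Affine (to_ac (x0 - e0)) y"] on'
    unfolding double[symmetric] by (simp del: ec_add.simps)
  then have c': "c' = 0" by (simp add: on_curve_def)
  have "to_ac (x0 - e0) \<noteq> 0" "to_ac b' = to_ac (x0 - e0)^2"
    using double_is_origin[of "to_ac a'" "to_ac b'" "to_ac (x0 - e0)" y] on' double c' by simp_all
  then have d0: "x0 - e0 \<noteq> 0" and b': "b' = (x0 - e0)^2"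
    by (simp_all flip: to_ac_diff to_ac_power del: to_ac_diff to_ac_power)
  have "elliptic_curve (change_curve C' E)"
    by (rule elliptic_curve_change_curve[OF _ ell]) (simp add: C'_def u0)
  then have "a'^2 - 4 * (x0 - e0)^2 \<noteq> 0"
    unfolding M' c' b' elliptic_curve_def discriminant_two_torsion_form by simp
  moreover have "is_model E C' (Weierstrass 0 a' 0 ((x0 - e0)^2) 0)"
    using M' c' b' u0 by (simp add: is_model_def C'_def)
  moreover have "ec_add (map_weierstrass to_ac (Weierstrass 0 a' 0 ((x0 - e0)^2) 0))
      (change_point_Qbar C' R) (change_point_Qbar C' R) = Affine 0 0"
    using double unfolding xe c' b' by (simp del: ec_add.simps)
  moreover have "xcoord (change_point_Qbar C' R) = to_ac (x0 - e0)" by (simp add: xe)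
  ultimately show ?thesis using d0 by blast
qed

lemma rational_xcoord_change_point:
  fixes R :: "rat alg_closure ec_point"
  assumes "cu C \<noteq> 0" "R \<noteq> Infinity"
  shows "xcoord (change_point_Qbar C R) \<in> \<rat> \<longleftrightarrow> xcoord R \<in> \<rat>"
proof -
  obtain x y where R: "R = Affine x y" using assms(2) by (cases R) auto
  obtain u r s t where C: "C = Coord_change u r s t" by (cases C)
  let ?x' = "(x - to_ac r) / to_ac u ^ 2"
  have ac: "to_ac q \<in> \<rat>" for q :: rat by (simp add: Rats_alg_closure)
  have x: "x = to_ac u ^ 2 * ?x' + to_ac r" using assms(1) by (simp add: C)
  have "?x' \<in> \<rat> \<Longrightarrow> x \<in> \<rat>"
    by (subst x) (intro Rats_add Rats_mult Rats_power ac)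
  moreover have "x \<in> \<rat> \<Longrightarrow> ?x' \<in> \<rat>" by (intro Rats_diff Rats_divide Rats_power ac)
  ultimately have "?x' \<in> \<rat> \<longleftrightarrow> x \<in> \<rat>" by blast
  then show ?thesis by (simp add: C R)
qed

theorem proposition3p2:
  fixes E M :: "rat weierstrass" and C :: "rat coord_change"
    and R :: "rat alg_closure ec_point"
  assumes "elliptic_curve E"
    and "has_order (ec_group_Qbar E) R 4"
    and "is_model E C M"
  defines "cond_i \<equiv> galois_stable (generate (ec_group_Qbar E) {R})"
    and "cond_ii \<equiv> \<forall>\<sigma>\<in>Gal_Qbar. map_ec_point \<sigma> R \<in> {R, inv\<^bsub>ec_group_Qbar E\<^esub> R}"
    and "cond_iii \<equiv> xcoord (change_point_Qbar C R) \<in> \<rat>"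
    and "cond_iv \<equiv> \<exists>\<gamma> \<delta> :: rat. \<exists>C' :: rat coord_change.
           \<delta> \<noteq> 0 \<and> \<gamma>^2 - 4 * \<delta>^2 \<noteq> 0 \<and>
           is_model E C' (Weierstrass 0 \<gamma> 0 (\<delta>^2) 0) \<and>
           xcoord (change_point_Qbar C' R) \<in> {to_ac \<delta>, - to_ac \<delta>} \<and>
           change_point_Qbar C' R [^]\<^bsub>ec_group_Qbar (Weierstrass 0 \<gamma> 0 (\<delta>^2) 0)\<^esub> (2::nat)
             = Affine 0 0"
  shows "(cond_i \<longleftrightarrow> cond_ii) \<and> (cond_ii \<longleftrightarrow> cond_iii) \<and> (cond_iii \<longleftrightarrow> cond_iv)"
proof -
  let ?W = "map_weierstrass to_ac E"
  note R = order_four_basics[OF assms(2)]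
  have inv: "inv\<^bsub>ec_group_Qbar E\<^esub> R = ec_neg ?W R" by (rule ec_group_inv[OF R(1)])
  have "cond_i \<longleftrightarrow> cond_ii"
    unfolding cond_i_def cond_ii_def inv by (rule galois_stable_iff_conjugates_pm[OF assms(2)])
  moreover have "cond_ii \<longleftrightarrow> cond_iii"
    unfolding cond_ii_def cond_iii_def inv by (rule conjugates_pm_iff_rational_xcoord[OF R(1,3) assms(3)])
  moreover have "cond_iii \<longleftrightarrow> cond_iv"
  proof
    assume cond_iii
    then show cond_iv
      using rational_xcoord_imp_normal_form[OF assms(1-3)]
      unfolding cond_iii_def cond_iv_def ec_group_square by blast
  next
    assume cond_iv
    then obtain \<gamma> \<delta> :: rat and C' where C': "is_model E C' (Weierstrass 0 \<gamma> 0 (\<delta>^2) 0)"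
      and x: "xcoord (change_point_Qbar C' R) \<in> {to_ac \<delta>, - to_ac \<delta>}"
      unfolding cond_iv_def by blast
    have "xcoord (change_point_Qbar C' R) \<in> \<rat>"
      using x by (auto simp: Rats_alg_closure simp flip: to_ac_minus)
    then show cond_iii
      using C' assms(3) R(3) unfolding cond_iii_def is_model_def
      by (simp add: rational_xcoord_change_point)
  qed
  ultimately show ?thesis by blast
qed

end
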